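(* Let $\Delta$ be a complete $n$-dimensional fan, and let $1_\Delta\in I(\Delta)$ be the constant function $1$. If $w(c,d)$ is any $cd$-monomial of degree $n$, then the integer $w(C,D)(1_\Delta)$ is the coefficient of the monomial $w(c,d)$ in the $cd$-index of $\Delta$.
   Context: **Fans.** A fan $\Delta$ in $\mathbb{R}^n$ is a finite collection of pointed polyhedral cones (not necessarily rational), closed under taking faces, any two of which intersect in a common face. It is complete if its union is $\mathbb{R}^n$. It is a poset under the face relation ($\tau\le\sigma$ if $\tau$ is a face of $\sigma$). $\Delta^{\le m}$ denotes the $m$-skeleton (cones of dimension $\le m$); thus $\Delta^{\le n}=\Delta$ and $\Delta^{\le 0}=\{0\}$. **Operations.** $I(\Delta^{\le m})$ is the set of functions $f:\Delta^{\le m}\to\mathbb{Z}$. Define $E:I(\Delta^{\le m})\to I(\Delta^{\le m})$ by $$E(f)(\sigma)=\sum_{\tau\in\Delta^{\le m},\ \sigma\le\tau}(-1)^{m-\dim\tau}f(\tau).$$ Let $C:I(\Delta^{\le m})\to I(\Delta^{\le m-1})$ be the restriction, and let $D:I(\Delta^{\le m})\to I(\Delta^{\le m-2})$ be $D=C\circ(E-\mathrm{Id})\circ C$, where $E$ is the operator on $I(\Delta^{\le m-1})$. For a $cd$-monomial $w(c,d)$ of degree $n$ (with $\deg c=1$, $\deg d=2$), $w(C,D)$ is the composition of operators obtained by replacing $c$ by $C$ and $d$ by $D$ (the rightmost letter is applied first); it maps $I(\Delta)=I(\Delta^{\le n})$ to $I(\Delta^{\le 0})=\mathbb{Z}$.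 **The $cd$-index.** For $S\subset\{1,\dots,n\}$ let $f_S$ be the number of chains $\sigma_1<\dots<\sigma_k$ of nonzero cones of $\Delta$ with $\{\dim\sigma_1,\dots,\dim\sigma_k\}=S$, $k=|S|$ (so $f_\emptyset=1$). Put $h_T=\sum_{S\subset T}(-1)^{|T\setminus S|}f_S$ and $P_n(\Delta)=\sum_{T\subset\{1,\dots,n\}}h_T\,t^T$, $t^T=\prod_{i\in T}t_i$. Let $c,d$ be non-commuting variables of degree $1$ and $2$, and let $\phi:\mathbb{R}\langle c,d\rangle\to\mathbb{R}[t_1,t_2,\dots]$ be the injective linear map with $\phi(1)=1$ and, for $f$ homogeneous of degree $k$, $\phi(fc)=\phi(f)(t_{k+1}+1)$, $\phi(fd)=\phi(f)(t_{k+1}+t_{k+2})$. It is known that $P_n(\Delta)=\phi(\Phi)$ for a unique homogeneous polynomial $\Phi$ of degree $n$ in the non-commuting variables $c,d$; this $\Phi$ is the $cd$-index of $\Delta$. *)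

theory Defs
  imports "HOL-Analysis.Analysis" "HOL-Library.Poly_Mapping" "HOL-Library.FuncSet"
begin

section \<open>Fans\<close>

text \<open>The last condition implies \<open>0 \<in> \<sigma>\<close>, so the empty set is not a cone here.\<close>

definition pointed_polyhedral_cone :: "'a::euclidean_space set \<Rightarrow> bool" where
  "pointed_polyhedral_cone \<sigma> \<longleftrightarrow> polyhedron \<sigma> \<and> cone \<sigma> \<and> \<sigma> \<inter> uminus ` \<sigma> = {0}"

text \<open>In the library the empty set is a face of every convex set; faces of cones are nonempty.\<close>

definition fan :: "'a::euclidean_space set set \<Rightarrow> bool" where
  "fan \<Delta> \<longleftrightarrow> finite \<Delta>
     \<and> (\<forall>\<sigma>\<in>\<Delta>. pointed_polyhedral_cone \<sigma>)
     \<and> (\<forall>\<sigma>\<in>\<Delta>. \<forall>\<tau>. \<tau> face_of \<sigma> \<and> \<tau> \<noteq> {} \<longrightarrow> \<tau> \<in> \<Delta>)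
     \<and> (\<forall>\<sigma>\<in>\<Delta>. \<forall>\<tau>\<in>\<Delta>. (\<sigma> \<inter> \<tau>) face_of \<sigma> \<and> (\<sigma> \<inter> \<tau>) face_of \<tau>)"

text \<open>A complete fan in the vector space \<open>V\<close>, a linear subspace of the ambient type.  An
  \<open>n\<close>-dimensional such \<open>V\<close> plays the role of Euclidean \<open>n\<close>-space; unlike \<open>UNIV :: (real ^ 'n) set\<close>
  it may have dimension 0.\<close>

definition complete_fan :: "'a::euclidean_space set \<Rightarrow> 'a set set \<Rightarrow> bool" where
  "complete_fan V \<Delta> \<longleftrightarrow> subspace V \<and> fan \<Delta> \<and> \<Union>\<Delta> = V"

definition skel :: "'a::euclidean_space set set \<Rightarrow> nat \<Rightarrow> 'a set set" where
  "skel \<Delta> m = {\<sigma>\<in>\<Delta>. dim \<sigma> \<le> m}"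


section \<open>Words in the noncommuting letters \<open>c\<close> and \<open>d\<close>\<close>

datatype cd_letter = Letter_c | Letter_d

type_synonym cd_word = "cd_letter list"

fun letter_deg :: "cd_letter \<Rightarrow> nat" where
  "letter_deg Letter_c = 1"
| "letter_deg Letter_d = 2"

definition cd_deg :: "cd_word \<Rightarrow> nat" where
  "cd_deg w = (\<Sum>l\<leftarrow>w. letter_deg l)"


section \<open>The operators\<close>

text \<open>An element of \<open>I(\<Delta>\<^sup>\<le>\<^sup>m)\<close> is a function in \<open>skel \<Delta> m \<rightarrow>\<^sub>E UNIV\<close>, i.e.\ it is
  \<open>undefined\<close> off the skeleton.  The index \<open>m\<close> is always that of the source.\<close>

definition op_E :: "'a::euclidean_space set set \<Rightarrow> nat \<Rightarrow> ('a set \<Rightarrow> int) \<Rightarrow> ('a set \<Rightarrow> int)" where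
  "op_E \<Delta> m f = (\<lambda>\<sigma>\<in>skel \<Delta> m. \<Sum>\<tau> | \<tau> \<in> skel \<Delta> m \<and> \<sigma> face_of \<tau>. (-1) ^ (m - dim \<tau>) * f \<tau>)"

definition op_C :: "'a::euclidean_space set set \<Rightarrow> nat \<Rightarrow> ('a set \<Rightarrow> int) \<Rightarrow> ('a set \<Rightarrow> int)" where
  "op_C \<Delta> m f = restrict f (skel \<Delta> (m - 1))"

definition op_D :: "'a::euclidean_space set set \<Rightarrow> nat \<Rightarrow> ('a set \<Rightarrow> int) \<Rightarrow> ('a set \<Rightarrow> int)" where
  "op_D \<Delta> m f =
     op_C \<Delta> (m - 1) (\<lambda>\<sigma>\<in>skel \<Delta> (m - 1). op_E \<Delta> (m - 1) (op_C \<Delta> m f) \<sigma> - op_C \<Delta> m f \<sigma>)"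

fun letter_op ::
    "'a::euclidean_space set set \<Rightarrow> cd_letter \<Rightarrow> nat \<Rightarrow> ('a set \<Rightarrow> int) \<Rightarrow> ('a set \<Rightarrow> int)" where
  "letter_op \<Delta> Letter_c m = op_C \<Delta> m"
| "letter_op \<Delta> Letter_d m = op_D \<Delta> m"

text \<open>\<open>word_op \<Delta> m w\<close> is \<open>w(C,D)\<close> with source \<open>I(\<Delta>\<^sup>\<le>\<^sup>m)\<close>.  The head of a word is its leftmost
  letter and hence is applied last, when the preceding operators have already lowered the
  skeleton by the degree of the tail.\<close>

fun word_op ::
    "'a::euclidean_space set set \<Rightarrow> nat \<Rightarrow> cd_word \<Rightarrow> ('a set \<Rightarrow> int) \<Rightarrow> ('a set \<Rightarrow> int)" where
  "word_op \<Delta> m [] = (\<lambda>f. f)"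
| "word_op \<Delta> m (l # w) = letter_op \<Delta> l (m - cd_deg w) \<circ> word_op \<Delta> m w"

definition one_fun :: "'a::euclidean_space set set \<Rightarrow> 'a set \<Rightarrow> int" where
  "one_fun \<Delta> = (\<lambda>\<sigma>\<in>\<Delta>. 1)"


section \<open>Flag numbers\<close>

definition flag_f :: "'a::euclidean_space set set \<Rightarrow> nat set \<Rightarrow> int" where
  "flag_f \<Delta> S = int (card {K. K \<subseteq> \<Delta> - {{0}} \<and> Complete_Partial_Order.chain (face_of) K
                              \<and> dim ` K = S \<and> card K = card S})"

definition flag_h :: "'a::euclidean_space set set \<Rightarrow> nat set \<Rightarrow> int" where
  "flag_h \<Delta> T = (\<Sum>S\<in>Pow T. (-1) ^ card (T - S) * flag_f \<Delta> S)"


section \<open>The cd-index\<close>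

text \<open>Commutative polynomials in \<open>t\<^sub>1, t\<^sub>2, \<dots>\<close>: finitely supported maps from exponent vectors to
  coefficients, with the ring structure from the library.\<close>

type_synonym tpoly = "(nat \<Rightarrow>\<^sub>0 nat) \<Rightarrow>\<^sub>0 real"

definition tvar :: "nat \<Rightarrow> tpoly" where
  "tvar i = Poly_Mapping.single (Poly_Mapping.single i 1) 1"

definition tconst :: "real \<Rightarrow> tpoly" where
  "tconst a = Poly_Mapping.single 0 a"

definition flag_poly :: "nat \<Rightarrow> 'a::euclidean_space set set \<Rightarrow> tpoly" where
  "flag_poly n \<Delta> = (\<Sum>T\<in>Pow {1..n}. tconst (of_int (flag_h \<Delta> T)) * (\<Prod>i\<in>T. tvar i))"

text \<open>Noncommutative polynomials in \<open>c, d\<close>: finitely supported maps from words to coefficients.\<close>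

type_synonym cd_poly = "cd_word \<Rightarrow>\<^sub>0 real"

definition cd_homogeneous :: "nat \<Rightarrow> cd_poly \<Rightarrow> bool" where
  "cd_homogeneous n \<Phi> \<longleftrightarrow> (\<forall>w\<in>Poly_Mapping.keys \<Phi>. cd_deg w = n)"

text \<open>The map \<open>\<phi>\<close> is defined recursively by splitting off the last letter, hence the
  recursion on the reversed word; the defining equations in terms of words are stated below.\<close>

fun phi_rev :: "cd_word \<Rightarrow> tpoly" where
  "phi_rev [] = 1"
| "phi_rev (Letter_c # u) = phi_rev u * (tvar (cd_deg u + 1) + 1)"
| "phi_rev (Letter_d # u) = phi_rev u * (tvar (cd_deg u + 1) + tvar (cd_deg u + 2))"

definition phi_word :: "cd_word \<Rightarrow> tpoly" where
  "phi_word w = phi_rev (rev w)"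

lemma cd_deg_rev [simp]: "cd_deg (rev w) = cd_deg w"
  unfolding cd_deg_def by (simp add: rev_map[symmetric])

lemma phi_word_Nil: "phi_word [] = 1"
  by (simp add: phi_word_def)

lemma phi_word_snoc_c:
  "phi_word (w @ [Letter_c]) = phi_word w * (tvar (cd_deg w + 1) + 1)"
  by (simp add: phi_word_def)

lemma phi_word_snoc_d:
  "phi_word (w @ [Letter_d]) = phi_word w * (tvar (cd_deg w + 1) + tvar (cd_deg w + 2))"
  by (simp add: phi_word_def)

definition phi :: "cd_poly \<Rightarrow> tpoly" where
  "phi \<Phi> = (\<Sum>w\<in>Poly_Mapping.keys \<Phi>. tconst (Poly_Mapping.lookup \<Phi> w) * phi_word w)"

text \<open>For a complete fan in an \<open>n\<close>-dimensional space such a \<open>\<Phi>\<close> exists and is unique.\<close>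

definition cd_index :: "nat \<Rightarrow> 'a::euclidean_space set set \<Rightarrow> cd_poly" where
  "cd_index n \<Delta> = (THE \<Phi>. cd_homogeneous n \<Phi> \<and> flag_poly n \<Delta> = phi \<Phi>)"

end

theory Submission
  imports Defs
begin

text \<open>Write \<open>f\<close> for a function on the cones of dimension at most \<open>m\<close>.  Weight every chain of nonzero
  cones by the value of \<open>f\<close> at its largest member (at \<open>{0}\<close> for the empty chain), and form from the
  weighted flag numbers the polynomial \<open>P\<^sub>m(f)\<close> exactly as \<open>flag_poly\<close> is formed from the unweighted
  ones; thus \<open>flag_poly n \<Delta> = P\<^sub>n(1)\<close>.  Splitting chains according to whether they contain a cone of
  dimension \<open>m\<close> gives \<open>P\<^sub>m(f) = P\<^bsub>m-1\<^esub>(f) + t\<^sub>m P\<^bsub>m-1\<^esub>(Tf - f)\<close>, where \<open>Tf\<close> sums \<open>f\<close> over the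
  \<open>m\<close>-dimensional cones above a given cone.  On lower cones \<open>T = E\<^sub>m + E\<^bsub>m-1\<^esub>\<close>, so that
  \<open>P\<^sub>m(f) = P\<^bsub>m-1\<^esub>(f) + t\<^sub>m P\<^bsub>m-1\<^esub>(E\<^bsub>m-1\<^esub> f)\<close> as soon as \<open>E\<^sub>m f = f\<close>.

  Let \<open>R\<^sub>m(f)\<close> be the right-hand side of the last equation, for arbitrary \<open>f\<close>.  Since \<open>E\<close> is an
  involution and \<open>Ef = f\<close> on the cones of top dimension, \<open>g = E\<^bsub>m-1\<^esub> f - f\<close> vanishes in dimension
  \<open>m - 1\<close> and satisfies \<open>E\<^bsub>m-1\<^esub> g = - g\<close>; hence \<open>E\<^bsub>m-2\<^esub> g = g\<close>, and a short calculation gives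
  \<open>R\<^sub>m(f) = (t\<^sub>m + 1) R\<^bsub>m-1\<^esub>(Cf) + (t\<^bsub>m-1\<^esub> + t\<^sub>m) R\<^bsub>m-2\<^esub>(Df)\<close> (\<open>paired_h_poly_rec\<close>).  This is the
  recursion that defines \<open>\<phi>\<close>, and unrolling it writes \<open>R\<^sub>n(f)\<close> as the sum of
  \<open>w(C,D)(f) \<phi>(w)\<close> over the words \<open>w\<close> of degree \<open>n\<close> (\<open>paired_h_poly_words\<close>).  For \<open>f = 1\<close> this is
  the flag polynomial, because \<open>E\<^sub>n 1 = 1\<close> on a complete fan.  As \<open>\<phi>\<close> is injective in each degree
  (\<open>phi_words_independent\<close>), the coefficients \<open>w(C,D)(1)\<close> are those of the cd-index, whose existence
  is obtained on the way.

  Two facts about fans enter: \<open>E\<close> is an involution because the signed count of the faces between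
  two distinct cones vanishes (\<open>cone_face_interval_euler\<close>), and \<open>E\<^sub>n 1 = 1\<close> because the signed count of
  the cones above a given cone of a complete fan is \<open>(-1)\<^sup>n\<close> (\<open>complete_fan_star_euler\<close>).  Both follow
  from one Euler relation for partitions of an affine space into relatively open polyhedra
  (\<open>local_euler_relation\<close>), which rests on the remark that cutting a relatively open convex cell of
  dimension \<open>k\<close> by a hyperplane leaves its sign unchanged: \<open>(-1)\<^sup>k = (-1)\<^sup>k + (-1)\<^bsup>k-1\<^esup> + (-1)\<^sup>k\<close>.\<close>

section \<open>Signed cell counts in hyperplane arrangements\<close>

text \<open>The Euler characteristic with compact supports of a relatively open convex cell.  The value 0 on
  the empty set lets sums run over all sign patterns, realised or not.\<close>

definition cell_sign :: "'a::euclidean_space set \<Rightarrow> int" where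
  "cell_sign S = (if S = {} then 0 else (-1) ^ nat (aff_dim S))"

lemma cell_sign_empty [simp]: "cell_sign {} = 0"
  by (simp add: cell_sign_def)

definition sign_side :: "'a::euclidean_space \<times> real \<Rightarrow> real \<Rightarrow> 'a set" where
  "sign_side h s = {y. sgn (fst h \<bullet> y - snd h) = s}"

definition sign_cell :: "('a::euclidean_space \<times> real) set \<Rightarrow> ('a \<times> real \<Rightarrow> real) \<Rightarrow> 'a set" where
  "sign_cell H s = {y. \<forall>h\<in>H. sgn (fst h \<bullet> y - snd h) = s h}"

lemma sign_side_simps:
  "sign_side (a, b) 1 = {y. a \<bullet> y > b}"
  "sign_side (a, b) 0 = {y. a \<bullet> y = b}"
  "sign_side (a, b) (-1) = {y. a \<bullet> y < b}"
  by (auto simp: sign_side_def sgn_if)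

lemma open_imp_rel_open: "open S \<Longrightarrow> rel_open (S :: 'a::euclidean_space set)"
  by (simp add: rel_open_def rel_interior_open)

lemma convex_rel_open_Int:
  fixes S T :: "'a::euclidean_space set"
  assumes "convex S" "rel_open S" "convex T" "rel_open T"
  shows "convex (S \<inter> T) \<and> rel_open (S \<inter> T)"
  using convex_rel_open_finite_Inter[of "{S, T}"] assms by auto

lemma convex_rel_open_sign_side:
  assumes "v \<in> {-1, 0, 1}"
  shows "convex (sign_side h v) \<and> rel_open (sign_side h v)"
proof -
  obtain a b where h: "h = (a, b)" by (cases h)
  have "open {y. a \<bullet> y > b}" "open {y. a \<bullet> y < b}"
    by (simp_all add: open_halfspace_gt open_halfspace_lt)
  moreover have "affine {y. a \<bullet> y = b}" by (rule affine_hyperplane)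
  moreover have "convex {y. a \<bullet> y > b}" "convex {y. a \<bullet> y < b}"
    by (simp_all add: convex_halfspace_gt convex_halfspace_lt)
  ultimately show ?thesis
    using assms unfolding h by (auto simp: sign_side_simps open_imp_rel_open affine_rel_open affine_imp_convex)
qed

text \<open>A cell meeting the hyperplane without lying in it meets both open sides, because it is relatively
  open, and is cut into two cells of its own dimension and one of dimension one less.\<close>

lemma cell_sign_cut:
  fixes C :: "'a::euclidean_space set"
  assumes "convex C" "rel_open C"
  shows "(\<Sum>v\<in>{-1, 0, 1}. cell_sign (C \<inter> sign_side h v)) = cell_sign C"
proof -
  obtain a b where h: "h = (a, b)" by (cases h)
  let ?L = "C \<inter> {y. a \<bullet> y < b}" and ?E = "C \<inter> {y. a \<bullet> y = b}" and ?G = "C \<inter> {y. a \<bullet> y > b}"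
  have un: "C = ?L \<union> ?E \<union> ?G" by auto
  have opn: "aff_dim ?L = aff_dim C" if "?L \<noteq> {}" 
    using that assms by (intro aff_dim_convex_Int_open) (auto simp: open_halfspace_lt)
  have opn': "aff_dim ?G = aff_dim C" if "?G \<noteq> {}"
    using that assms by (intro aff_dim_convex_Int_open) (auto simp: open_halfspace_gt)
  have ope: "openin (top_of_set (affine hull C)) C"
    using assms rel_open by blast
  have main: "cell_sign ?L + cell_sign ?E + cell_sign ?G = cell_sign C"
  proof (cases "?E = {}")
    case True
    have "?L = {} \<or> ?G = {}"
    proof (rule ccontr)
      assume "\<not> ?thesis"
      then obtain x y where xy: "x \<in> C" "a \<bullet> x < b" "y \<in> C" "a \<bullet> y > b" by auto
      have "\<exists>z\<in>C. a \<bullet> z = b"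
        using connected_ivt_hyperplane[OF convex_connected[OF assms(1)] xy(1,3)] xy(2,4) by auto
      then show False using True by auto
    qed
    then show ?thesis
    proof
      assume "?L = {}"
      then have "?G = C" using True un by auto
      then show ?thesis using \<open>?L = {}\<close> True by simp
    next
      assume "?G = {}"
      then have "?L = C" using True un by auto
      then show ?thesis using \<open>?G = {}\<close> True by simp
    qed
  next
    case False
    then obtain z where z: "z \<in> C" "a \<bullet> z = b" by auto
    show ?thesis
    proof (cases "C \<subseteq> {y. a \<bullet> y = b}")
      case True
      then have "?E = C" "?L = {}" "?G = {}" by auto
      then show ?thesis by simp
    next
      case nsub: False
      then obtain x where x: "x \<in> C" "a \<bullet> x \<noteq> b" by auto
      \<comment> \<open>Prolonging the segment from \<open>x\<close> to \<open>z\<close> beyond \<open>z\<close> inside \<open>C\<close> crosses to the other side of the hyperplane.\<close>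
      obtain e where e: "e > 1" "(1 - e) *\<^sub>R x + e *\<^sub>R z \<in> C"
        using convex_rel_interior_iff[OF assms(1)] z(1) x(1) assms(2) unfolding rel_open_def by blast
      have val: "a \<bullet> ((1 - e) *\<^sub>R x + e *\<^sub>R z) - b = (e - 1) * (b - a \<bullet> x)"
        using z by (simp add: inner_add_right algebra_simps)
      have LG: "?L \<noteq> {}" "?G \<noteq> {}"
      proof -
        have "\<exists>y\<in>C. a \<bullet> y < b" "\<exists>y\<in>C. a \<bullet> y > b"
          using x e val mult_pos_pos[of "e - 1" "b - a \<bullet> x"] mult_pos_neg[of "e - 1" "b - a \<bullet> x"]
          by (smt (verit))+
        then show "?L \<noteq> {}" "?G \<noteq> {}" by auto
      qed
      have "aff_dim ?E = aff_dim (affine hull C \<inter> {y. a \<bullet> y = b})"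
      proof -
        have "openin (top_of_set (affine hull C \<inter> {y. a \<bullet> y = b})) ?E"
          using ope by (metis openin_subtopology_Int subtopology_subtopology)
        then show ?thesis
          using aff_dim_openin[OF _ _ False] by (simp add: affine_Int affine_hyperplane)
      qed
      also have "\<dots> = aff_dim C - 1"
        using aff_dim_affine_Int_hyperplane[of "affine hull C" a b] z nsub hull_subset[of C affine]
        by (auto simp: hull_inc)
      finally have E: "aff_dim ?E = aff_dim C - 1" .
      have "aff_dim ?E \<ge> 0" using False using aff_dim_negative_iff[of "?E"] by linarith
      then have "nat (aff_dim C) = Suc (nat (aff_dim ?E))" using E by simp
      moreover have "C \<noteq> {}" using x by auto
      ultimately show ?thesis
        using opn[OF LG(1)] opn'[OF LG(2)] LG False by (simp add: cell_sign_def)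
    qed
  qed
  then show ?thesis by (simp add: h sign_side_simps)
qed

lemma sign_cell_insert:
  "sign_cell (insert h H) s = sign_cell H s \<inter> sign_side h (s h)"
  by (auto simp: sign_cell_def sign_side_def)

lemma cell_sign_arrangement:
  fixes C :: "'a::euclidean_space set"
  assumes "finite H" "convex C" "rel_open C"
  shows "(\<Sum>s\<in>H \<rightarrow>\<^sub>E {-1, 0, 1}. cell_sign (C \<inter> sign_cell H s)) = cell_sign C"
  using assms
proof (induction H arbitrary: C rule: finite_induct)
  case empty
  then show ?case by (simp add: sign_cell_def)
next
  case (insert h H)
  have upd: "sign_cell H (s(h := v)) = sign_cell H s" for s v
    using insert.hyps by (auto simp: sign_cell_def)
  let ?V = "{-1, 0, 1} :: real set"
  have "(\<Sum>s\<in>insert h H \<rightarrow>\<^sub>E ?V. cell_sign (C \<inter> sign_cell (insert h H) s))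
      = (\<Sum>(v, s)\<in>?V \<times> (H \<rightarrow>\<^sub>E ?V). cell_sign (C \<inter> sign_side h v \<inter> sign_cell H s))"
    unfolding PiE_insert_eq
    by (subst sum.reindex) (auto intro!: inj_combinator sum.cong simp: insert.hyps sign_cell_insert upd inf.assoc inf.left_commute Int_commute)
  also have "\<dots> = (\<Sum>v\<in>?V. \<Sum>s\<in>H \<rightarrow>\<^sub>E ?V. cell_sign (C \<inter> sign_side h v \<inter> sign_cell H s))"
    by (rule sum.cartesian_product[symmetric])
  also have "\<dots> = (\<Sum>v\<in>?V. cell_sign (C \<inter> sign_side h v))"
  proof (rule sum.cong[OF refl])
    fix v assume "v \<in> ?V"
    then have "convex (C \<inter> sign_side h v) \<and> rel_open (C \<inter> sign_side h v)"
      using convex_rel_open_Int[OF insert.prems] convex_rel_open_sign_side by blast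
    then show "(\<Sum>s\<in>H \<rightarrow>\<^sub>E ?V. cell_sign (C \<inter> sign_side h v \<inter> sign_cell H s))
      = cell_sign (C \<inter> sign_side h v)"
      using insert.IH by blast
  qed
  also have "\<dots> = cell_sign C" by (rule cell_sign_cut[OF insert.prems])
  finally show ?case .
qed

text \<open>Indiscernibility by the hyperplanes \<open>{x. a \<bullet> x = b}\<close> with \<open>(a, b) \<in> H\<close>.  The sets that are
  unions of cells of such an arrangement are closed under Boolean operations, which reaches
  relative interiors of polyhedra without any explicit inequalities for them.\<close>

definition same_signs :: "('a::euclidean_space \<times> real) set \<Rightarrow> 'a \<Rightarrow> 'a \<Rightarrow> bool" where
  "same_signs H x y \<longleftrightarrow> (\<forall>h\<in>H. sgn (fst h \<bullet> x - snd h) = sgn (fst h \<bullet> y - snd h))"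

definition sign_definable :: "('a::euclidean_space \<times> real) set \<Rightarrow> 'a set \<Rightarrow> bool" where
  "sign_definable H A \<longleftrightarrow> (\<forall>x y. same_signs H x y \<longrightarrow> (x \<in> A \<longleftrightarrow> y \<in> A))"

lemma same_signs_sym: "same_signs H x y \<Longrightarrow> same_signs H y x"
  by (simp add: same_signs_def)

lemma same_signs_Un: "same_signs (H \<union> H') x y \<longleftrightarrow> same_signs H x y \<and> same_signs H' x y"
  unfolding same_signs_def by (rule ball_Un)

lemma same_signs_UN: "same_signs (\<Union>i\<in>I. H i) x y \<longleftrightarrow> (\<forall>i\<in>I. same_signs (H i) x y)"
  unfolding same_signs_def by simp

lemma same_signs_mono: "same_signs H' x y \<Longrightarrow> H \<subseteq> H' \<Longrightarrow> same_signs H x y"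
  unfolding same_signs_def by (meson subsetD)

lemma sign_definableI:
  assumes "\<And>x y. same_signs H x y \<Longrightarrow> x \<in> A \<Longrightarrow> y \<in> A"
  shows "sign_definable H A"
  unfolding sign_definable_def using assms same_signs_sym by blast

lemma sign_definable_mono: "sign_definable H A \<Longrightarrow> H \<subseteq> H' \<Longrightarrow> sign_definable H' A"
  unfolding sign_definable_def using same_signs_mono by blast

lemma sign_definable_Int:
  "sign_definable H A \<Longrightarrow> sign_definable H' B \<Longrightarrow> sign_definable (H \<union> H') (A \<inter> B)"
  unfolding sign_definable_def same_signs_Un by blast

lemma sign_definable_Diff:
  "sign_definable H A \<Longrightarrow> sign_definable H' B \<Longrightarrow> sign_definable (H \<union> H') (A - B)"
  unfolding sign_definable_def same_signs_Un by blast

lemma sign_definable_Union: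
  "(\<And>i. i \<in> I \<Longrightarrow> sign_definable (H i) (A i)) \<Longrightarrow> sign_definable (\<Union>i\<in>I. H i) (\<Union>i\<in>I. A i)"
  unfolding sign_definable_def same_signs_UN by blast

text \<open>The signed number of cells of a partition depends only on the union: refining every part by an
  arrangement that defines all of them yields the cells of that arrangement inside the union.\<close>

lemma cell_sign_partition:
  fixes U :: "'a::euclidean_space set"
  assumes "finite I" and "finite H"
    and U: "convex U" "rel_open U"
    and C: "\<And>i. i \<in> I \<Longrightarrow> convex (C i) \<and> rel_open (C i) \<and> sign_definable H (C i)"
    and disj: "disjoint_family_on C I" and cover: "(\<Union>i\<in>I. C i) = U"
  shows "(\<Sum>i\<in>I. cell_sign (C i)) = cell_sign U"
proof -
  let ?S = "H \<rightarrow>\<^sub>E ({-1, 0, 1} :: real set)"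
  have "(\<Sum>i\<in>I. cell_sign (C i)) = (\<Sum>i\<in>I. \<Sum>s\<in>?S. cell_sign (C i \<inter> sign_cell H s))"
    using C assms(2) by (intro sum.cong refl cell_sign_arrangement[symmetric]) auto
  also have "\<dots> = (\<Sum>s\<in>?S. \<Sum>i\<in>I. cell_sign (C i \<inter> sign_cell H s))"
    by (rule sum.swap)
  also have "\<dots> = (\<Sum>s\<in>?S. cell_sign (U \<inter> sign_cell H s))"
  proof (rule sum.cong[OF refl])
    fix s assume "s \<in> ?S"
    show "(\<Sum>i\<in>I. cell_sign (C i \<inter> sign_cell H s)) = cell_sign (U \<inter> sign_cell H s)"
    proof (cases "U \<inter> sign_cell H s = {}")
      case True
      then have "C i \<inter> sign_cell H s = {}" if "i \<in> I" for i using cover that by auto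
      then show ?thesis using True by simp
    next
      case False
      then obtain x i where x: "x \<in> sign_cell H s" "i \<in> I" "x \<in> C i" using cover by auto
      have sub: "sign_cell H s \<subseteq> C i"
      proof
        fix y assume "y \<in> sign_cell H s"
        then have "same_signs H x y" using x(1) by (simp add: sign_cell_def same_signs_def)
        then show "y \<in> C i" using C[OF x(2)] x(3) unfolding sign_definable_def by blast
      qed
      have "C j \<inter> sign_cell H s = {}" if "j \<in> I - {i}" for j
        using that sub disj x(2) unfolding disjoint_family_on_def by blast
      then have "(\<Sum>i\<in>I. cell_sign (C i \<inter> sign_cell H s)) = cell_sign (C i \<inter> sign_cell H s)"
        using sum.remove[OF assms(1) x(2), of "\<lambda>i. cell_sign (C i \<inter> sign_cell H s)"] by simp
      moreover have "C i \<inter> sign_cell H s = U \<inter> sign_cell H s" using sub cover x(2) by auto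
      ultimately show ?thesis by simp
    qed
  qed
  also have "\<dots> = cell_sign U"
    by (rule cell_sign_arrangement[OF assms(2) U])
  finally show ?thesis .
qed

lemma polyhedron_sign_definable:
  assumes "polyhedron P"
  shows "\<exists>H. finite H \<and> sign_definable H P"
proof -
  obtain F where F: "finite F" "P = \<Inter>F" "\<forall>h\<in>F. \<exists>a b. a \<noteq> 0 \<and> h = {x. a \<bullet> x \<le> b}"
    using assms unfolding polyhedron_def by blast
  then obtain a b where ab: "\<And>h. h \<in> F \<Longrightarrow> h = {x. a h \<bullet> x \<le> b h}" by metis
  have "sign_definable ((\<lambda>h. (a h, b h)) ` F) P"
  proof (rule sign_definableI)
    fix x y assume *: "same_signs ((\<lambda>h. (a h, b h)) ` F) x y"
      and "x \<in> P"
    have "y \<in> h" if "h \<in> F" for h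
    proof -
      have "a h \<bullet> x \<le> b h" using \<open>x \<in> P\<close> that F(2) ab[OF that] by blast
      moreover have "sgn (a h \<bullet> x - b h) = sgn (a h \<bullet> y - b h)"
        using * that unfolding same_signs_def by auto
      ultimately have "a h \<bullet> y \<le> b h" by (auto simp: sgn_if split: if_splits)
      then show ?thesis using ab[OF that] by blast
    qed
    then show "y \<in> P" using F(2) by blast
  qed
  then show ?thesis using F(1) by blast
qed

text \<open>The relative interior is the polyhedron minus its finitely many facets, which are polyhedra.\<close>

lemma rel_interior_polyhedron_sign_definable:
  assumes "polyhedron P"
  shows "\<exists>H. finite H \<and> sign_definable H (rel_interior P)"
proof -
  obtain H where H: "finite H" "sign_definable H P" using polyhedron_sign_definable[OF assms] by blast
  have "\<exists>H. finite H \<and> sign_definable H F" if "F \<in> {F. F facet_of P}" for F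
    using that assms face_of_polyhedron_polyhedron facet_of_imp_face_of polyhedron_sign_definable by blast
  then obtain K where K: "\<And>F. F \<in> {F. F facet_of P} \<Longrightarrow> finite (K F) \<and> sign_definable (K F) F"
    by metis
  have "rel_interior P = P - (\<Union>F\<in>{F. F facet_of P}. F)"
    using rel_boundary_of_polyhedron[OF assms] rel_interior_subset[of P] by auto
  moreover have "sign_definable (H \<union> (\<Union>F\<in>{F. F facet_of P}. K F)) (P - (\<Union>F\<in>{F. F facet_of P}. F))"
    using H K by (intro sign_definable_Diff sign_definable_Union) auto
  ultimately show ?thesis
    using H K finite_polyhedron_facets[OF assms] by (intro exI[of _ "H \<union> (\<Union>F\<in>{F. F facet_of P}. K F)"]) auto
qed

lemma box_sign_definable:
  fixes a b :: "'a::euclidean_space"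
  shows "\<exists>H. finite H \<and> sign_definable H (box a b)"
proof (intro exI conjI)
  show "finite ((\<lambda>i. (i, a \<bullet> i)) ` Basis \<union> (\<lambda>i. (i, b \<bullet> i)) ` (Basis :: 'a set))" by simp
  show "sign_definable ((\<lambda>i. (i, a \<bullet> i)) ` Basis \<union> (\<lambda>i. (i, b \<bullet> i)) ` Basis) (box a b)"
  proof (rule sign_definableI)
    fix x y assume *: "same_signs ((\<lambda>i. (i, a \<bullet> i)) ` Basis \<union> (\<lambda>i. (i, b \<bullet> i)) ` Basis) x y"
      and x: "x \<in> box a b"
    show "y \<in> box a b"
      unfolding mem_box
    proof (rule ballI)
      fix i :: 'a assume i: "i \<in> Basis"
      then have "sgn (i \<bullet> x - a \<bullet> i) = sgn (i \<bullet> y - a \<bullet> i)" "sgn (i \<bullet> x - b \<bullet> i) = sgn (i \<bullet> y - b \<bullet> i)"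
        using bspec[OF *[unfolded same_signs_def], of "(i, a \<bullet> i)"]
          bspec[OF *[unfolded same_signs_def], of "(i, b \<bullet> i)"] by auto
      moreover have "a \<bullet> i < x \<bullet> i" "x \<bullet> i < b \<bullet> i" using x i by (auto simp: mem_box)
      ultimately show "a \<bullet> i < y \<bullet> i \<and> y \<bullet> i < b \<bullet> i"
        by (auto simp: sgn_if inner_commute split: if_splits)
    qed
  qed
qed

text \<open>Only the polyhedra through \<open>x\<close> meet a small box around \<open>x\<close>, and each of them has
  relative interior points in the box.  Intersecting everything with the box gives two partitions of the same set: the
  pieces of the polyhedra, and the single cell cut out of \<open>U\<close>.\<close>

lemma local_euler_relation:
  fixes U :: "'a::euclidean_space set"
  assumes "finite I" and U: "affine U" "x \<in> U"
    and P: "\<And>i. i \<in> I \<Longrightarrow> polyhedron (A i)"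
    and disj: "disjoint_family_on (\<lambda>i. rel_interior (A i)) I"
    and cover: "(\<Union>i\<in>I. rel_interior (A i)) = U"
  shows "(\<Sum>i | i \<in> I \<and> x \<in> A i. (-1) ^ nat (aff_dim (A i))) = ((-1) ^ nat (aff_dim U) :: int)"
proof -
  define K where "K = (\<Union>i\<in>{i\<in>I. x \<notin> A i}. A i)"
  have "closed K" unfolding K_def using assms(1) P by (intro closed_UN) (auto simp: polyhedron_imp_closed)
  moreover have "x \<notin> K" by (auto simp: K_def)
  ultimately obtain e where e: "e > 0" "ball x e \<subseteq> - K"
    using open_contains_ball[of "- K"] by (auto simp: open_Compl)
  obtain a b where ab: "x \<in> box a b" "box a b \<subseteq> ball x e" using rational_boxes[OF e(1)] by blast
  define Q where "Q = box a b"
  have Q: "open Q" "convex Q" "x \<in> Q" "rel_open Q" "Q \<inter> K = {}"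
    using ab e by (auto simp: Q_def open_box convex_box open_imp_rel_open)
  let ?J = "{i\<in>I. x \<in> A i}"
  define C where "C i = rel_interior (A i) \<inter> Q" for i
  obtain HQ where HQ: "finite HQ" "sign_definable HQ Q" using box_sign_definable unfolding Q_def by blast
  obtain HI where HI: "\<And>i. i \<in> I \<Longrightarrow> finite (HI i) \<and> sign_definable (HI i) (rel_interior (A i))"
    using rel_interior_polyhedron_sign_definable[OF P] by metis
  define H where "H = (\<Union>i\<in>I. HI i) \<union> HQ"
  have *: "(\<Sum>i\<in>?J. cell_sign (C i)) = cell_sign (U \<inter> Q)"
  proof (rule cell_sign_partition[where H = H])
    show "finite ?J" "finite H" using assms(1) HI HQ by (auto simp: H_def)
    show "convex (U \<inter> Q)" "rel_open (U \<inter> Q)"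
      using convex_rel_open_Int[of U Q] U Q by (auto simp: affine_imp_convex affine_rel_open)
    show "convex (C i) \<and> rel_open (C i) \<and> sign_definable H (C i)" if "i \<in> ?J" for i
    proof -
      have "convex (A i)" using P that polyhedron_imp_convex by auto
      then have "convex (C i) \<and> rel_open (C i)"
        unfolding C_def using Q by (intro convex_rel_open_Int) (auto simp: convex_rel_interior rel_interior_rel_open)
      moreover have "sign_definable (HI i \<union> HQ) (C i)"
        unfolding C_def using HI HQ that by (intro sign_definable_Int) auto
      then have "sign_definable H (C i)" 
        by (rule sign_definable_mono) (use that in \<open>auto simp: H_def\<close>)
      ultimately show ?thesis by blast
    qed
    show "disjoint_family_on C ?J"
      using disj unfolding disjoint_family_on_def C_def by blast
    show "(\<Union>i\<in>?J. C i) = U \<inter> Q"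
    proof
      show "(\<Union>i\<in>?J. C i) \<subseteq> U \<inter> Q" using cover by (auto simp: C_def)
      show "U \<inter> Q \<subseteq> (\<Union>i\<in>?J. C i)"
      proof
        fix y assume y: "y \<in> U \<inter> Q"
        then obtain i where i: "i \<in> I" "y \<in> rel_interior (A i)" using cover by auto
        have "y \<notin> K" using y Q by auto
        then have "x \<in> A i" using i rel_interior_subset by (auto simp: K_def)
        then show "y \<in> (\<Union>i\<in>?J. C i)" using i y by (auto simp: C_def)
      qed
    qed
  qed
  have "cell_sign (C i) = (-1) ^ nat (aff_dim (A i))" if i: "i \<in> ?J" for i
  proof -
    have cv: "convex (A i)" using P i polyhedron_imp_convex by auto
    have "x \<in> closure (rel_interior (A i))"
      using convex_closure_rel_interior[OF cv] i closure_subset by auto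
    then have ne: "C i \<noteq> {}" using Q unfolding C_def closure_iff_nhds_not_empty by blast
    then have "aff_dim (C i) = aff_dim (A i)"
      unfolding C_def using aff_dim_convex_Int_open[OF convex_rel_interior[OF cv] Q(1)] rel_interior_aff_dim[OF cv] by simp
    then show ?thesis using ne by (simp add: cell_sign_def)
  qed
  moreover have "cell_sign (U \<inter> Q) = (-1) ^ nat (aff_dim U)"
  proof -
    have "U \<inter> Q \<noteq> {}" using U Q by auto
    then show ?thesis using aff_dim_convex_Int_open[OF affine_imp_convex[OF U(1)] Q(1)] by (simp add: cell_sign_def)
  qed
  ultimately show ?thesis using * by simp
qed

section \<open>Euler relations for pointed cones and complete fans\<close>

lemma pointed_coneD:
  assumes "pointed_polyhedral_cone \<sigma>"
  shows "0 \<in> \<sigma>" "polyhedron \<sigma>" "convex \<sigma>" "closed \<sigma>" "cone \<sigma>"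
    "\<And>x. x \<in> \<sigma> \<Longrightarrow> - x \<in> \<sigma> \<Longrightarrow> x = 0" 
    and "nat (aff_dim \<sigma>) = dim \<sigma>"
proof -
  have *: "\<sigma> \<inter> uminus ` \<sigma> = {0}" and p: "polyhedron \<sigma>" and "cone \<sigma>"
    using assms by (auto simp: pointed_polyhedral_cone_def)
  then show z: "0 \<in> \<sigma>" "polyhedron \<sigma>" "convex \<sigma>" "closed \<sigma>" "cone \<sigma>"
    by (auto simp: polyhedron_imp_convex polyhedron_imp_closed)
  show "\<And>x. x \<in> \<sigma> \<Longrightarrow> - x \<in> \<sigma> \<Longrightarrow> x = 0"
    using * by (metis Int_iff add.inverse_inverse image_eqI singletonD)
  have "0 \<in> affine hull \<sigma>" using z(1) by (rule hull_inc)
  then show "nat (aff_dim \<sigma>) = dim \<sigma>" by (simp add: aff_dim_zero)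
qed

lemma face_of_pointed_cone:
  assumes "pointed_polyhedral_cone \<sigma>" "\<tau> face_of \<sigma>" "\<tau> \<noteq> {}"
  shows "pointed_polyhedral_cone \<tau>"
proof -
  note p = pointed_coneD[OF assms(1)]
  have "conic \<tau>" using face_of_conic[OF _ assms(2)] p(5) by (simp add: conic_def cone_def)
  then have c: "cone \<tau>" by (simp add: conic_def cone_def)
  then have "0 \<in> \<tau>" using assms(3) cone_contains_0 by blast
  moreover have "\<tau> \<subseteq> \<sigma>" using assms(2) by (rule face_of_imp_subset)
  moreover have "v = 0" if "v \<in> \<tau>" "- v \<in> \<tau>" for v
    using p(6) that \<open>\<tau> \<subseteq> \<sigma>\<close> by (meson subsetD)
  ultimately have "\<tau> \<inter> uminus ` \<tau> = {0}" by (auto simp: image_iff)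
  then show ?thesis
    using c face_of_polyhedron_polyhedron[OF p(2) assms(2)] by (simp add: pointed_polyhedral_cone_def)
qed

lemma in_rel_interior_of_face:
  fixes P :: "'a::euclidean_space set"
  assumes "polyhedron P" "x \<in> P"
  shows "\<exists>F. F face_of P \<and> x \<in> rel_interior F"
  using assms
proof (induction "nat (aff_dim P)" arbitrary: P rule: less_induct)
  case less
  show ?case
  proof (cases "x \<in> rel_interior P")
    case True
    then show ?thesis using less.prems(1) face_of_refl polyhedron_imp_convex by blast
  next
    case False
    then obtain F where F: "F facet_of P" "x \<in> F"
      using rel_boundary_of_polyhedron[OF less.prems(1)] less.prems(2) by blast
    have "aff_dim F \<ge> 0" using F(2) aff_dim_negative_iff[of F] by (metis empty_iff not_le)
    then have "nat (aff_dim F) < nat (aff_dim P)" using F(1) by (simp add: facet_of_def)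
    moreover have "polyhedron F"
      using F(1) less.prems(1) face_of_polyhedron_polyhedron facet_of_imp_face_of by blast
    ultimately obtain G where "G face_of F" "x \<in> rel_interior G" using less.hyps F(2) by blast
    then show ?thesis using F(1) face_of_trans facet_of_imp_face_of by blast
  qed
qed

lemma fanD:
  assumes "fan \<Delta>"
  shows "finite \<Delta>" "\<And>\<sigma>. \<sigma> \<in> \<Delta> \<Longrightarrow> pointed_polyhedral_cone \<sigma>"
    "\<And>\<sigma> \<tau>. \<sigma> \<in> \<Delta> \<Longrightarrow> \<tau> face_of \<sigma> \<Longrightarrow> \<tau> \<noteq> {} \<Longrightarrow> \<tau> \<in> \<Delta>"
    "\<And>\<sigma> \<tau>. \<sigma> \<in> \<Delta> \<Longrightarrow> \<tau> \<in> \<Delta> \<Longrightarrow> (\<sigma> \<inter> \<tau>) face_of \<sigma> \<and> (\<sigma> \<inter> \<tau>) face_of \<tau>"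
  using assms unfolding fan_def by blast+

text \<open>A point in the relative interior of \<open>\<sigma>\<close> stands for \<open>\<sigma>\<close> in the face order, so sums over the cones
  above \<open>\<sigma>\<close> become sums over the cones through a point.\<close>

lemma rel_interior_point_in_cone_iff:
  assumes "fan \<Delta>" "\<sigma> \<in> \<Delta>" "\<tau> \<in> \<Delta>" "x \<in> rel_interior \<sigma>"
  shows "x \<in> \<tau> \<longleftrightarrow> \<sigma> face_of \<tau>"
proof
  assume "x \<in> \<tau>"
  have f: "(\<sigma> \<inter> \<tau>) face_of \<sigma>" "(\<sigma> \<inter> \<tau>) face_of \<tau>" using fanD(4)[OF assms(1-3)] by auto
  have "\<sigma> \<subseteq> \<sigma> \<inter> \<tau>"
    using subset_of_face_of[OF f(1) order_refl] \<open>x \<in> \<tau>\<close> assms(4) rel_interior_subset by blast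
  then have "\<sigma> \<inter> \<tau> = \<sigma>" by auto
  then show "\<sigma> face_of \<tau>" using f(2) by simp
next
  assume "\<sigma> face_of \<tau>"
  then show "x \<in> \<tau>" using assms(4) rel_interior_subset face_of_imp_subset by blast
qed

lemma fan_rel_interior_nonempty:
  assumes "fan \<Delta>" "\<sigma> \<in> \<Delta>"
  shows "rel_interior \<sigma> \<noteq> {}"
  using pointed_coneD(1,3)[OF fanD(2)[OF assms]] rel_interior_eq_empty by blast

lemma complete_fan_star_euler:
  assumes "complete_fan V \<Delta>" "\<sigma> \<in> \<Delta>"
  shows "(\<Sum>\<tau> | \<tau> \<in> \<Delta> \<and> \<sigma> face_of \<tau>. (-1) ^ dim \<tau>) = ((-1) ^ dim V :: int)"
proof -
  have fan: "fan \<Delta>" and V: "subspace V" "\<Union>\<Delta> = V" using assms by (auto simp: complete_fan_def)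
  obtain x where x: "x \<in> rel_interior \<sigma>" using fan_rel_interior_nonempty[OF fan assms(2)] by blast
  have "(\<Sum>\<tau> | \<tau> \<in> \<Delta> \<and> x \<in> \<tau>. (-1) ^ nat (aff_dim \<tau>)) = ((-1) ^ nat (aff_dim V) :: int)"
  proof (rule local_euler_relation)
    show "finite \<Delta>" "affine V" using fanD(1)[OF fan] subspace_imp_affine[OF V(1)] .
    show "x \<in> V" using x V(2) assms(2) rel_interior_subset by blast
    show "polyhedron \<tau>" if "\<tau> \<in> \<Delta>" for \<tau> using pointed_coneD(2) fanD(2)[OF fan that] by blast
    show "disjoint_family_on rel_interior \<Delta>"
      unfolding disjoint_family_on_def
    proof (intro ballI impI equals0I)
      fix \<tau> \<rho> z assume *: "\<tau> \<in> \<Delta>" "\<rho> \<in> \<Delta>" "\<tau> \<noteq> \<rho>" "z \<in> rel_interior \<tau> \<inter> rel_interior \<rho>"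
      then have "\<tau> face_of \<rho>" "\<rho> face_of \<tau>"
        using rel_interior_point_in_cone_iff[OF fan] rel_interior_subset by blast+
      then show False using * face_of_imp_subset by blast
    qed
    show "\<Union> (rel_interior ` \<Delta>) = V"
    proof
      show "\<Union> (rel_interior ` \<Delta>) \<subseteq> V" using V(2) rel_interior_subset by blast
      show "V \<subseteq> \<Union> (rel_interior ` \<Delta>)"
      proof
        fix z assume "z \<in> V"
        then obtain \<tau> where \<tau>: "\<tau> \<in> \<Delta>" "z \<in> \<tau>" using V(2) by blast
        then obtain F where "F face_of \<tau>" "z \<in> rel_interior F"
          using in_rel_interior_of_face pointed_coneD(2) fanD(2)[OF fan] by blast
        then show "z \<in> \<Union> (rel_interior ` \<Delta>)"
          using fanD(3)[OF fan \<tau>(1)] rel_interior_empty by blast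
      qed
    qed
  qed
  moreover have "{\<tau>. \<tau> \<in> \<Delta> \<and> x \<in> \<tau>} = {\<tau>. \<tau> \<in> \<Delta> \<and> \<sigma> face_of \<tau>}"
    using rel_interior_point_in_cone_iff[OF fan assms(2) _ x] by blast
  moreover have "nat (aff_dim V) = dim V" using V(1) by (simp add: aff_dim_subspace)
  ultimately show ?thesis using pointed_coneD(7)[OF fanD(2)[OF fan]] by simp
qed

lemma rel_interior_cone_scale:
  fixes S :: "'a::euclidean_space set"
  assumes "cone S" "x \<in> rel_interior S" "c > 0"
  shows "c *\<^sub>R x \<in> rel_interior S"
proof -
  have "(*\<^sub>R) c ` S = S"
    using assms(1,3) cone_iff[of S] rel_interior_subset[of S] assms(2) by auto
  then show ?thesis using rel_interior_scaleR[of c S] assms by (metis image_eqI less_irrefl)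
qed

lemma rel_interior_cone_add:
  fixes S :: "'a::euclidean_space set"
  assumes "convex S" "cone S" "y \<in> rel_interior S" "v \<in> S" "t > 0"
  shows "v + t *\<^sub>R y \<in> rel_interior S"
proof -
  have "t *\<^sub>R y \<in> rel_interior S" using rel_interior_cone_scale assms by blast
  then have "v - (1/2) *\<^sub>R (v - t *\<^sub>R y) \<in> rel_interior S"
    using rel_interior_convex_shrink[OF assms(1) _ assms(4), of "t *\<^sub>R y" "1/2"] by simp
  then have "2 *\<^sub>R (v - (1/2) *\<^sub>R (v - t *\<^sub>R y)) \<in> rel_interior S"
    using rel_interior_cone_scale[OF assms(2)] by simp
  moreover have "2 *\<^sub>R (v - (1/2) *\<^sub>R (v - t *\<^sub>R y)) = v + t *\<^sub>R y"
    by (simp add: algebra_simps scaleR_2)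
  ultimately show ?thesis by simp
qed

text \<open>A line in the direction of a relative interior point \<open>y\<close> eventually enters the cone.  It cannot
  stay inside when followed backwards, as \<open>- y\<close> would then be a limit of points of the cone,
  contradicting pointedness.\<close>

lemma cone_line_exit_point:
  fixes \<rho> :: "'a::euclidean_space set"
  assumes \<rho>: "pointed_polyhedral_cone \<rho>" and y: "y \<in> rel_interior \<rho>" "y \<noteq> 0" and z: "z \<in> span \<rho>"
  shows "\<exists>t. z + t *\<^sub>R y \<in> \<rho> - rel_interior \<rho>"
proof -
  note p = pointed_coneD[OF \<rho>]
  define T where "T = {t. z + t *\<^sub>R y \<in> \<rho>}"
  have aff: "affine hull \<rho> = span \<rho>" using hull_inc[OF p(1)] by (rule affine_hull_span_0)
  \<comment> \<open>A relative interior point can be moved a little in every direction of the span, since the affine hull is the span.\<close>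
  have small: "\<exists>e>0. u + e *\<^sub>R w \<in> \<rho>" if uw: "u \<in> rel_interior \<rho>" "w \<in> span \<rho>" for u w
  proof -
    obtain r where r: "r > 0" "ball u r \<inter> span \<rho> \<subseteq> \<rho>"
      using uw(1) unfolding rel_interior_ball aff by blast
    define e where "e = r / (2 * (norm w + 1))"
    have e: "e > 0" using r by (simp add: e_def add_nonneg_pos)
    have "norm (e *\<^sub>R w) < r"
    proof -
      have "norm (e *\<^sub>R w) = r * (norm w / (2 * (norm w + 1)))" using e r by (simp add: e_def)
      also have "\<dots> < r * 1" using r by (intro mult_strict_left_mono) (auto simp: add_nonneg_pos divide_less_eq)
      finally show ?thesis by simp
    qed
    then have "u + e *\<^sub>R w \<in> ball u r" by (simp add: dist_norm)
    moreover have "u + e *\<^sub>R w \<in> span \<rho>"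
      using uw rel_interior_subset[of \<rho>] by (intro span_add span_mul) (auto intro: span_base)
    ultimately show ?thesis using r e by blast
  qed
  have ysp: "y \<in> span \<rho>" using y(1) rel_interior_subset span_base by blast
  obtain e where e: "e > 0" "y + e *\<^sub>R z \<in> \<rho>" using small[OF y(1) z] by blast
  have "(1/e) *\<^sub>R (y + e *\<^sub>R z) \<in> \<rho>" using p(5) e by (simp add: cone_def)
  then have ne: "1/e \<in> T" using e by (simp add: T_def algebra_simps)
  have cl: "closed T"
  proof -
    have "T = (\<lambda>t. z + t *\<^sub>R y) -` \<rho>" by (auto simp: T_def)
    then show ?thesis using p(4) by (auto intro!: continuous_closed_vimage continuous_intros)
  qed
  have bdd: "bdd_below T"
  proof (rule ccontr)
    assume nb: "\<not> bdd_below T"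
    have "\<exists>t\<in>T. t < - real n - 1" for n :: nat
      using nb unfolding bdd_below_def by (meson not_le)
    then obtain f where f: "\<And>n. f n \<in> T" "\<And>n :: nat. f n < - real n - 1" by metis
    define g where "g n = (- 1 / f n) *\<^sub>R z - y" for n
    have neg: "f n < 0" for n using f(2)[of n] by linarith
    have "g n \<in> \<rho>" for n
    proof -
      have "(- 1 / f n) *\<^sub>R (z + f n *\<^sub>R y) \<in> \<rho>"
        using mem_cone[OF p(5), of "z + f n *\<^sub>R y" "- 1 / f n"] f(1)[of n] neg[of n]
        by (simp add: T_def divide_nonpos_neg)
      moreover have "(- 1 / f n) *\<^sub>R (z + f n *\<^sub>R y) = g n"
        using neg[of n] by (simp add: g_def scaleR_add_right)
      ultimately show ?thesis by simp
    qed
    moreover have "g \<longlonglongrightarrow> 0 *\<^sub>R z - y"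
    proof -
      have "(\<lambda>n. - 1 / f n) \<longlonglongrightarrow> 0"
      proof (rule tendsto_sandwich[OF _ _ tendsto_const])
        show "eventually (\<lambda>n. 0 \<le> - 1 / f n) sequentially"
          using neg by (intro always_eventually allI divide_nonpos_neg) auto
        show "eventually (\<lambda>n. - 1 / f n \<le> 1 / real (Suc n)) sequentially"
        proof (rule always_eventually, rule allI)
          fix n
          have "1 / (- f n) \<le> 1 / real (Suc n)" using f(2)[of n] by (intro frac_le) auto
          then show "- 1 / f n \<le> 1 / real (Suc n)" by simp
        qed
        show "(\<lambda>n. 1 / real (Suc n)) \<longlonglongrightarrow> 0" using LIMSEQ_inverse_real_of_nat by (simp add: inverse_eq_divide)
      qed
      then show ?thesis unfolding g_def by (intro tendsto_intros)
    qed
    ultimately have "- y \<in> \<rho>" using closed_sequentially[OF p(4)] by force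
    then show False using p(6) y rel_interior_subset by blast
  qed
  define t where "t = Inf T"
  have t: "t \<in> T" unfolding t_def using closed_contains_Inf[OF _ bdd cl] ne by blast
  have "z + t *\<^sub>R y \<notin> rel_interior \<rho>"
  proof
    assume "z + t *\<^sub>R y \<in> rel_interior \<rho>"
    moreover have "- y \<in> span \<rho>" using ysp by (rule span_neg)
    ultimately obtain d where d: "d > 0" "(z + t *\<^sub>R y) + d *\<^sub>R (- y) \<in> \<rho>" using small by blast
    then have "t - d \<in> T" by (simp add: T_def algebra_simps)
    then have "t \<le> t - d" unfolding t_def using bdd by (rule cInf_lower)
    then show False using d(1) by simp
  qed
  then show ?thesis using t by (auto simp: T_def)
qed

lemma proper_face_not_in_span:
  fixes \<rho> :: "'a::euclidean_space set"
  assumes "convex \<rho>" "\<tau> face_of \<rho>" "\<tau> \<noteq> \<rho>" "0 \<in> \<tau>" "y \<in> rel_interior \<rho>"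
  shows "y \<notin> span \<tau>"
proof -
  have "affine hull \<tau> \<inter> rel_interior \<rho> = {}"
    using affine_hull_face_of_disjoint_rel_interior[OF assms(1-3)] by blast
  then show ?thesis using assms(4,5) by (auto simp: affine_hull_span_0 hull_inc)
qed

text \<open>The orthogonal projection along \<open>y\<close> is injective on \<open>span \<tau>\<close> but not globally, while images of
  polyhedra and their dimensions are easiest under bijective linear maps.  Adding a multiple of \<open>y\<close>
  that depends on a component orthogonal to \<open>\<tau>\<close> repairs this and changes nothing on \<open>\<tau>\<close>.\<close>

lemma inj_extension_of_projection:
  fixes y :: "'a::euclidean_space"
  assumes "y \<notin> span \<tau>"
  shows "\<exists>g. linear g \<and> inj g \<and> (\<forall>v\<in>\<tau>. g v = v - ((v \<bullet> y) / (y \<bullet> y)) *\<^sub>R y)"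
proof -
  obtain u n where un: "u \<in> span \<tau>" "\<And>w. w \<in> span \<tau> \<Longrightarrow> orthogonal n w" "y = u + n"
    using orthogonal_subspace_decomp_exists[of \<tau> y] by metis
  have "n \<noteq> 0" using un assms by auto
  moreover have "n \<bullet> y = n \<bullet> n" using un(2)[OF un(1)] un(3) by (simp add: orthogonal_def inner_add_right)
  ultimately have ny: "n \<bullet> y \<noteq> 0" by simp
  then have y0: "y \<bullet> y \<noteq> 0" by auto
  define g where "g v = v - ((v \<bullet> y) / (y \<bullet> y)) *\<^sub>R y + (n \<bullet> v) *\<^sub>R y" for v
  have lin: "linear g"
    unfolding g_def by (intro linearI) (simp_all add: inner_add_left inner_add_right algebra_simps add_divide_distrib)
  have "inj g"
  proof (subst linear_injective_0[OF lin], intro allI impI)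
    fix v assume g0: "g v = 0"
    define s where "s = (v \<bullet> y) / (y \<bullet> y) - n \<bullet> v"
    have v: "v = s *\<^sub>R y" using g0 by (simp add: g_def s_def algebra_simps)
    have "g v = (s * (n \<bullet> y)) *\<^sub>R y" unfolding g_def v using y0 by simp
    then have "s = 0" using g0 ny y0 by auto
    then show "v = 0" using v by simp
  qed
  moreover have "g v = v - ((v \<bullet> y) / (y \<bullet> y)) *\<^sub>R y" if "v \<in> \<tau>" for v
    using un(2)[OF span_base[OF that]] by (simp add: g_def orthogonal_def)
  ultimately show ?thesis using lin by blast
qed

text \<open>Project the relative boundary of \<open>\<rho>\<close> along a relative interior point \<open>y\<close> to the hyperplane
  orthogonal to \<open>y\<close> in \<open>span \<rho>\<close>.  Every line parallel to \<open>y\<close> in that span meets the boundary exactly once, so the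
  proper faces become a partition of a space of dimension one less than \<open>\<rho>\<close>, and their signed count
  near \<open>\<sigma>\<close> is the opposite of the term for \<open>\<rho>\<close> itself.\<close>

lemma cone_face_interval_euler:
  fixes \<rho> :: "'a::euclidean_space set"
  assumes \<rho>: "pointed_polyhedral_cone \<rho>" and \<sigma>: "\<sigma> face_of \<rho>" "\<sigma> \<noteq> {}" "\<sigma> \<noteq> \<rho>"
  shows "(\<Sum>\<tau> | \<sigma> face_of \<tau> \<and> \<tau> face_of \<rho>. (-1) ^ dim \<tau>) = (0::int)"
proof -
  note p = pointed_coneD[OF \<rho>]
  have disj: "\<tau> \<inter> rel_interior \<rho> = {}" if "\<tau> face_of \<rho>" "\<tau> \<noteq> \<rho>" for \<tau>
    using that by (rule face_of_disjoint_rel_interior)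
  obtain y where y: "y \<in> rel_interior \<rho>" using p(1,3) rel_interior_eq_empty by blast
  have "0 \<in> \<sigma>" using face_of_pointed_cone[OF \<rho> \<sigma>(1,2)] pointed_coneD(1) by blast
  then have y0: "y \<noteq> 0" using disj[OF \<sigma>(1,3)] y by auto
  define \<pi> where "\<pi> v = v - ((v \<bullet> y) / (y \<bullet> y)) *\<^sub>R y" for v
  have lin: "linear \<pi>"
    unfolding \<pi>_def by (intro linearI) (simp_all add: inner_add_left algebra_simps add_divide_distrib)
  define U where "U = span \<rho> \<inter> {v. y \<bullet> v = 0}"
  have ysp: "y \<in> span \<rho>" using y rel_interior_subset span_base by blast
  have \<pi>U: "\<pi> v \<in> U" if "v \<in> span \<rho>" for v
    using that ysp y0 by (auto simp: \<pi>_def U_def inner_diff_right inner_commute intro!: span_diff span_mul)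
  have \<pi>_line: "\<pi> (z + t *\<^sub>R y) = z" if "z \<in> U" for z t
  proof -
    have "(z + t *\<^sub>R y) \<bullet> y = t * (y \<bullet> y)"
      using that by (simp add: U_def inner_add_left inner_commute[of z y])
    then show ?thesis using y0 by (simp add: \<pi>_def)
  qed
  define I where "I = {\<tau>. \<tau> face_of \<rho> \<and> \<tau> \<noteq> \<rho> \<and> \<tau> \<noteq> {}}"
  have finfaces: "finite {\<tau>. \<tau> face_of \<rho>}" by (rule finite_polyhedron_faces[OF p(2)])
  have I: "\<tau> face_of \<rho>" "pointed_polyhedral_cone \<tau>" "\<tau> \<inter> rel_interior \<rho> = {}" "\<tau> \<subseteq> \<rho>" "y \<notin> span \<tau>" if "\<tau> \<in> I" for \<tau>
  proof -
    have \<tau>: "\<tau> face_of \<rho>" "\<tau> \<noteq> \<rho>" "\<tau> \<noteq> {}" using that by (simp_all add: I_def)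
    show "\<tau> face_of \<rho>" by (rule \<tau>(1))
    show pc: "pointed_polyhedral_cone \<tau>" using face_of_pointed_cone[OF \<rho> \<tau>(1,3)] .
    show "\<tau> \<inter> rel_interior \<rho> = {}" using disj \<tau>(1,2) .
    show "\<tau> \<subseteq> \<rho>" using \<tau>(1) by (rule face_of_imp_subset)
    show "y \<notin> span \<tau>" using proper_face_not_in_span[OF p(3) \<tau>(1,2) pointed_coneD(1)[OF pc] y] .
  qed
  have inj: "u = v" if "\<tau> \<in> I" "\<tau>' \<in> I" "u \<in> \<tau>" "v \<in> \<tau>'" "\<pi> u = \<pi> v" for \<tau> \<tau>' u v
  proof -
    define t where "t = (u \<bullet> y) / (y \<bullet> y) - (v \<bullet> y) / (y \<bullet> y)"
    have uv: "u = v + t *\<^sub>R y" "v = u + (- t) *\<^sub>R y" using that(5) by (simp_all add: \<pi>_def t_def algebra_simps)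
    have "\<not> t > 0"
      using rel_interior_cone_add[OF p(3,5) y, of v t] uv(1) I(3,4) that(1-4) by blast
    moreover have "\<not> - t > 0"
      using rel_interior_cone_add[OF p(3,5) y, of u "- t"] uv(2) I(3,4) that(1-4) by blast
    ultimately show ?thesis using uv(1) by simp
  qed
  have poly: "polyhedron (\<pi> ` \<tau>)" and dimA: "nat (aff_dim (\<pi> ` \<tau>)) = dim \<tau>" if \<tau>: "\<tau> \<in> I" for \<tau>
  proof -
    obtain g where g: "linear g" "inj g" "\<forall>v\<in>\<tau>. g v = \<pi> v"
      using inj_extension_of_projection[OF I(5)[OF \<tau>]] unfolding \<pi>_def by blast
    have im: "\<pi> ` \<tau> = g ` \<tau>" using g(3) by force
    have "bij g" using g(1,2) linear_injective_imp_surjective by (auto simp: bij_def)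
    then show "polyhedron (\<pi> ` \<tau>)"
      unfolding im using polyhedron_linear_image_eq[OF g(1)] pointed_coneD(2)[OF I(2)[OF \<tau>]] by blast
    show "nat (aff_dim (\<pi> ` \<tau>)) = dim \<tau>"
      unfolding im using aff_dim_injective_linear_image[OF g(1,2)] pointed_coneD(7)[OF I(2)[OF \<tau>]] by simp
  qed
  have ri: "rel_interior (\<pi> ` \<tau>) = \<pi> ` rel_interior \<tau>" if "\<tau> \<in> I" for \<tau>
    using rel_interior_convex_linear_image[OF lin] pointed_coneD(3)[OF I(2)[OF that]] by simp
  obtain x where x: "x \<in> rel_interior \<sigma>"
    using \<sigma>(1,2) face_of_imp_convex rel_interior_eq_empty by blast
  have xs: "x \<in> \<sigma>" using x rel_interior_subset by blast
  have \<sigma>I: "\<sigma> \<in> I" using \<sigma> by (simp add: I_def)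
  have "(\<Sum>\<tau> | \<tau> \<in> I \<and> \<pi> x \<in> \<pi> ` \<tau>. (-1) ^ nat (aff_dim (\<pi> ` \<tau>))) = ((-1) ^ nat (aff_dim U) :: int)"
  proof (rule local_euler_relation)
    show "finite I" using finfaces by (rule rev_finite_subset) (auto simp: I_def)
    show "affine U" unfolding U_def by (intro affine_Int affine_hyperplane subspace_imp_affine subspace_span)
    show "\<pi> x \<in> U" using xs I(4)[OF \<sigma>I] by (intro \<pi>U span_base) auto
    show "polyhedron (\<pi> ` \<tau>)" if "\<tau> \<in> I" for \<tau> using poly that .
    show "disjoint_family_on (\<lambda>\<tau>. rel_interior (\<pi> ` \<tau>)) I"
      unfolding disjoint_family_on_def
    proof (intro ballI impI equals0I)
      fix \<tau> \<tau>' z assume *: "\<tau> \<in> I" "\<tau>' \<in> I" "\<tau> \<noteq> \<tau>'" "z \<in> rel_interior (\<pi> ` \<tau>) \<inter> rel_interior (\<pi> ` \<tau>')"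
      then obtain u v where uv: "u \<in> rel_interior \<tau>" "v \<in> rel_interior \<tau>'" "\<pi> u = \<pi> v" using ri by auto
      then have "u = v" using inj[OF *(1,2)] rel_interior_subset by blast
      then show False using uv(1,2) face_of_eq[OF I(1)[OF *(1)] I(1)[OF *(2)]] *(3) by blast
    qed
    show "(\<Union>\<tau>\<in>I. rel_interior (\<pi> ` \<tau>)) = U"
    proof
      show "(\<Union>\<tau>\<in>I. rel_interior (\<pi> ` \<tau>)) \<subseteq> U"
      proof
        fix z assume "z \<in> (\<Union>\<tau>\<in>I. rel_interior (\<pi> ` \<tau>))"
        then obtain \<tau> u where "\<tau> \<in> I" "u \<in> rel_interior \<tau>" "z = \<pi> u" using ri by auto
        then show "z \<in> U" using I(4)[of \<tau>] rel_interior_subset[of \<tau>] \<pi>U[of u] span_base[of u \<rho>] by blast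
      qed
      show "U \<subseteq> (\<Union>\<tau>\<in>I. rel_interior (\<pi> ` \<tau>))"
      proof
        fix z assume z: "z \<in> U"
        then have "z \<in> span \<rho>" by (simp add: U_def)
        then obtain t where t: "z + t *\<^sub>R y \<in> \<rho> - rel_interior \<rho>"
          using cone_line_exit_point[OF \<rho> y y0] by blast
        then obtain F where F: "F face_of \<rho>" "z + t *\<^sub>R y \<in> rel_interior F"
          using in_rel_interior_of_face[OF p(2)] by blast
        then have FI: "F \<in> I" using t rel_interior_subset by (auto simp: I_def)
        have "z \<in> \<pi> ` rel_interior F" using \<pi>_line[OF z, of t] F(2) by force
        then show "z \<in> (\<Union>\<tau>\<in>I. rel_interior (\<pi> ` \<tau>))" using ri[OF FI] FI by blast
      qed
    qed
  qed
  moreover have set_eq: "{\<tau>. \<tau> \<in> I \<and> \<pi> x \<in> \<pi> ` \<tau>} = {\<tau>. \<sigma> face_of \<tau> \<and> \<tau> face_of \<rho>} - {\<rho>}"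
  proof -
    have "\<pi> x \<in> \<pi> ` \<tau> \<longleftrightarrow> \<sigma> face_of \<tau>" if "\<tau> \<in> I" for \<tau>
    proof
      assume "\<pi> x \<in> \<pi> ` \<tau>"
      then obtain v where "v \<in> \<tau>" "\<pi> x = \<pi> v" by auto
      then have "x \<in> \<tau>" using inj[OF \<sigma>I that xs] by blast
      then have "\<sigma> \<subseteq> \<tau>"
        using subset_of_face_of[OF I(1)[OF that] face_of_imp_subset[OF \<sigma>(1)]] x by blast
      then show "\<sigma> face_of \<tau>" using face_of_subset \<sigma>(1) I(4)[OF that] by blast
    next
      assume "\<sigma> face_of \<tau>"
      then show "\<pi> x \<in> \<pi> ` \<tau>" using xs face_of_imp_subset by blast
    qed
    moreover have "\<tau> \<in> I" if "\<sigma> face_of \<tau>" "\<tau> face_of \<rho>" "\<tau> \<noteq> \<rho>" for \<tau>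
      using that \<sigma>(2) face_of_imp_subset by (auto simp: I_def)
    ultimately show ?thesis by (auto simp: I_def)
  qed
  moreover have "(\<Sum>\<tau>\<in>{\<tau>. \<tau> \<in> I \<and> \<pi> x \<in> \<pi> ` \<tau>}. (-1) ^ nat (aff_dim (\<pi> ` \<tau>)))
      = (\<Sum>\<tau>\<in>{\<tau>. \<tau> \<in> I \<and> \<pi> x \<in> \<pi> ` \<tau>}. (-1) ^ dim \<tau> :: int)"
    by (intro sum.cong refl) (simp add: dimA)
  moreover have dU: "dim \<rho> = Suc (nat (aff_dim U))"
  proof -
    have "aff_dim U = aff_dim (span \<rho>) - 1"
      using aff_dim_affine_Int_hyperplane[of "span \<rho>" y 0] ysp y0 \<pi>U[OF ysp]
      unfolding U_def by (auto simp: subspace_imp_affine[OF subspace_span])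
    moreover have "aff_dim (span \<rho>) = int (dim \<rho>)" using aff_dim_subspace[OF subspace_span] by simp
    moreover have "aff_dim U \<ge> 0" using aff_dim_negative_iff[of U] \<pi>U[OF ysp] by (metis empty_iff not_le)
    ultimately show ?thesis by simp
  qed
  ultimately have "(\<Sum>\<tau>\<in>{\<tau>. \<sigma> face_of \<tau> \<and> \<tau> face_of \<rho>} - {\<rho>}. (-1) ^ dim \<tau>) = - ((-1) ^ dim \<rho> :: int)"
    by simp
  moreover have "finite {\<tau>. \<sigma> face_of \<tau> \<and> \<tau> face_of \<rho>}"
    using finfaces by (rule rev_finite_subset) auto
  moreover have "\<rho> \<in> {\<tau>. \<sigma> face_of \<tau> \<and> \<tau> face_of \<rho>}" using \<sigma>(1) p(3) face_of_refl by blast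
  ultimately show ?thesis by (simp add: sum.remove[where x = \<rho>])
qed

lemma zero_face_of_pointed_cone:
  assumes "pointed_polyhedral_cone \<sigma>"
  shows "{0} face_of \<sigma>"
proof -
  note p = pointed_coneD[OF assms]
  have "a = 0 \<and> b = 0" if ab: "a \<in> \<sigma>" "b \<in> \<sigma>" and seg: "0 \<in> open_segment a b" for a b
  proof -
    obtain u where u: "0 < u" "u < 1" "0 = (1 - u) *\<^sub>R a + u *\<^sub>R b"
      using seg by (auto simp: in_segment)
    have "(1 - u) *\<^sub>R a \<in> \<sigma>" "u *\<^sub>R b \<in> \<sigma>" using mem_cone[OF p(5)] ab u(1,2) by simp_all
    moreover have "- ((1 - u) *\<^sub>R a) = u *\<^sub>R b" using u(3) by (simp add: minus_unique)
    ultimately have "(1 - u) *\<^sub>R a = 0" "u *\<^sub>R b = 0" using p(6) by (metis, metis minus_zero)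
    then show ?thesis using u(1,2) by simp
  qed
  then show ?thesis using p(1) unfolding face_of_def by auto
qed

locale nonempty_fan =
  fixes \<Delta> :: "'a::euclidean_space set set"
  assumes fan: "fan \<Delta>" and nonempty: "\<Delta> \<noteq> {}"
begin

lemma fin: "finite \<Delta>"
  by (rule fanD(1)[OF fan])

lemma zero_face: "\<tau> \<in> \<Delta> \<Longrightarrow> {0} face_of \<tau>"
  using fanD(2)[OF fan] zero_face_of_pointed_cone by blast

lemma zero_mem: "{0} \<in> \<Delta>"
  using nonempty zero_face fanD(3)[OF fan] by blast

lemma face_self: "\<sigma> \<in> \<Delta> \<Longrightarrow> \<sigma> face_of \<sigma>"
  using fanD(2)[OF fan] pointed_coneD(3) face_of_refl by blast

lemma cone_nonempty: "\<sigma> \<in> \<Delta> \<Longrightarrow> \<sigma> \<noteq> {}"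
  using fanD(2)[OF fan] pointed_coneD(1) by blast

lemma between:
  assumes "\<sigma> \<in> \<Delta>" "\<rho> \<in> \<Delta>" "\<sigma> face_of \<tau>" "\<tau> face_of \<rho>"
  shows "\<tau> \<in> \<Delta>"
proof -
  have "\<tau> \<noteq> {}" using cone_nonempty[OF assms(1)] face_of_imp_subset[OF assms(3)] by blast
  then show ?thesis using fanD(3)[OF fan assms(2,4)] by blast
qed

lemma face_dim:
  assumes "\<sigma> \<in> \<Delta>" "\<tau> \<in> \<Delta>" "\<sigma> face_of \<tau>"
  shows "dim \<sigma> \<le> dim \<tau> \<and> (dim \<sigma> = dim \<tau> \<longrightarrow> \<sigma> = \<tau>)"
proof (cases "\<sigma> = \<tau>")
  case False
  note p = pointed_coneD[OF fanD(2)[OF fan assms(1)]] pointed_coneD[OF fanD(2)[OF fan assms(2)]]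
  have "aff_dim \<sigma> < aff_dim \<tau>" using face_of_aff_dim_lt[OF p(10) assms(3) False] .
  moreover have "aff_dim \<sigma> \<ge> 0"
    using aff_dim_negative_iff[of \<sigma>] cone_nonempty[OF assms(1)] by (metis not_le)
  ultimately have "nat (aff_dim \<sigma>) < nat (aff_dim \<tau>)" by simp
  then show ?thesis using p(7,14) by simp
qed simp

lemma interval:
  assumes "\<sigma> \<in> \<Delta>" "\<rho> \<in> \<Delta>" "\<sigma> face_of \<rho>" "\<sigma> \<noteq> \<rho>"
  shows "(\<Sum>\<tau> | \<sigma> face_of \<tau> \<and> \<tau> face_of \<rho>. (-1) ^ dim \<tau>) = (0::int)"
using cone_face_interval_euler fanD(2)[OF fan] cone_nonempty assms by blast

end

section \<open>The alternating sums and the weighted flag polynomial\<close>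

definition top_sum :: "'a::euclidean_space set set \<Rightarrow> nat \<Rightarrow> ('a set \<Rightarrow> int) \<Rightarrow> 'a set \<Rightarrow> int" where
  "top_sum \<Delta> m f \<sigma> = (\<Sum>\<tau> | \<tau> \<in> \<Delta> \<and> dim \<tau> = m \<and> \<sigma> face_of \<tau>. f \<tau>)"

text \<open>The operator \<open>E\<close> without the restriction to the skeleton, which makes \<open>alt_sum_Suc\<close> hold at
  every \<open>\<sigma>\<close>.\<close>

definition alt_sum :: "'a::euclidean_space set set \<Rightarrow> nat \<Rightarrow> ('a set \<Rightarrow> int) \<Rightarrow> 'a set \<Rightarrow> int" where
  "alt_sum \<Delta> m f \<sigma> = (\<Sum>\<tau> | \<tau> \<in> skel \<Delta> m \<and> \<sigma> face_of \<tau>. (-1) ^ (m - dim \<tau>) * f \<tau>)"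

lemma top_sum_diff: "top_sum \<Delta> m (\<lambda>\<sigma>. f \<sigma> - g \<sigma>) \<sigma> = top_sum \<Delta> m f \<sigma> - top_sum \<Delta> m g \<sigma>"
  by (simp add: top_sum_def sum_subtractf)

lemma alt_sum_diff: "alt_sum \<Delta> m (\<lambda>\<sigma>. f \<sigma> - g \<sigma>) \<sigma> = alt_sum \<Delta> m f \<sigma> - alt_sum \<Delta> m g \<sigma>"
  by (simp add: alt_sum_def sum_subtractf right_diff_distrib)

lemma top_sum_cong: "(\<And>\<sigma>. \<sigma> \<in> skel \<Delta> m \<Longrightarrow> f \<sigma> = g \<sigma>) \<Longrightarrow> top_sum \<Delta> m f \<sigma> = top_sum \<Delta> m g \<sigma>"
  unfolding top_sum_def skel_def by (intro sum.cong) auto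

lemma alt_sum_cong: "(\<And>\<sigma>. \<sigma> \<in> skel \<Delta> m \<Longrightarrow> f \<sigma> = g \<sigma>) \<Longrightarrow> alt_sum \<Delta> m f \<sigma> = alt_sum \<Delta> m g \<sigma>"
  unfolding alt_sum_def by (intro sum.cong) auto

lemma alt_sum_Suc:
  assumes "finite \<Delta>"
  shows "alt_sum \<Delta> (Suc m) f \<sigma> = top_sum \<Delta> (Suc m) f \<sigma> - alt_sum \<Delta> m f \<sigma>"
proof -
  let ?A = "{\<tau>. \<tau> \<in> \<Delta> \<and> dim \<tau> = Suc m \<and> \<sigma> face_of \<tau>}" and ?B = "{\<tau>. \<tau> \<in> skel \<Delta> m \<and> \<sigma> face_of \<tau>}"
  let ?h = "\<lambda>\<tau>. (-1) ^ (Suc m - dim \<tau>) * f \<tau>"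
  have "{\<tau>. \<tau> \<in> skel \<Delta> (Suc m) \<and> \<sigma> face_of \<tau>} = ?A \<union> ?B" by (auto simp: skel_def)
  then have "alt_sum \<Delta> (Suc m) f \<sigma> = sum ?h (?A \<union> ?B)" by (simp add: alt_sum_def)
  also have "\<dots> = sum ?h ?A + sum ?h ?B"
    using assms by (intro sum.union_disjoint) (auto simp: skel_def)
  also have "sum ?h ?A = top_sum \<Delta> (Suc m) f \<sigma>" unfolding top_sum_def by (intro sum.cong) auto
  also have "sum ?h ?B = (\<Sum>\<tau>\<in>?B. - ((-1) ^ (m - dim \<tau>) * f \<tau>))"
    by (intro sum.cong) (auto simp: skel_def Suc_diff_le)
  also have "\<dots> = - alt_sum \<Delta> m f \<sigma>" by (simp add: alt_sum_def sum_negf)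
  finally show ?thesis by simp
qed

text \<open>The flag polynomial of \<open>\<Delta>\<close> up to dimension \<open>m\<close> in which each chain counts with the value of \<open>f\<close>
  at its largest member, as \<open>weighted_h_poly_expansion\<close> shows.\<close>

fun weighted_h_poly :: "'a::euclidean_space set set \<Rightarrow> nat \<Rightarrow> ('a set \<Rightarrow> int) \<Rightarrow> tpoly" where
  "weighted_h_poly \<Delta> 0 f = tconst (of_int (f {0}))"
| "weighted_h_poly \<Delta> (Suc m) f =
     weighted_h_poly \<Delta> m f + tvar (Suc m) * weighted_h_poly \<Delta> m (\<lambda>\<sigma>. top_sum \<Delta> (Suc m) f \<sigma> - f \<sigma>)"

lemma tconst_diff: "tconst (a - b) = tconst a - tconst b"
  by (simp add: tconst_def single_diff)

lemma weighted_h_poly_diff: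
  "weighted_h_poly \<Delta> m (\<lambda>\<sigma>. f \<sigma> - g \<sigma>) = weighted_h_poly \<Delta> m f - weighted_h_poly \<Delta> m g"
proof (induction m arbitrary: f g)
  case 0
  then show ?case by (simp add: tconst_diff)
next
  case (Suc m)
  have "(\<lambda>\<sigma>. top_sum \<Delta> (Suc m) (\<lambda>\<sigma>. f \<sigma> - g \<sigma>) \<sigma> - (f \<sigma> - g \<sigma>))
      = (\<lambda>\<sigma>. (top_sum \<Delta> (Suc m) f \<sigma> - f \<sigma>) - (top_sum \<Delta> (Suc m) g \<sigma> - g \<sigma>))"
    by (simp add: top_sum_diff algebra_simps)
  then show ?case by (simp only: weighted_h_poly.simps Suc.IH) (simp add: algebra_simps)
qed

lemma weighted_h_poly_add:
  "weighted_h_poly \<Delta> m (\<lambda>\<sigma>. f \<sigma> + g \<sigma>) = weighted_h_poly \<Delta> m f + weighted_h_poly \<Delta> m g"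
  using weighted_h_poly_diff[of \<Delta> m "\<lambda>\<sigma>. f \<sigma> + g \<sigma>" g] by simp

lemma weighted_h_poly_cong:
  assumes "{0} \<in> \<Delta>" "\<And>\<sigma>. \<sigma> \<in> skel \<Delta> m \<Longrightarrow> f \<sigma> = g \<sigma>"
  shows "weighted_h_poly \<Delta> m f = weighted_h_poly \<Delta> m g"
  using assms(2)
proof (induction m arbitrary: f g)
  case 0
  then show ?case using assms(1) by (simp add: skel_def)
next
  case (Suc m)
  have sub: "\<sigma> \<in> skel \<Delta> (Suc m)" if "\<sigma> \<in> skel \<Delta> m" for \<sigma> using that by (auto simp: skel_def)
  have "weighted_h_poly \<Delta> m f = weighted_h_poly \<Delta> m g"
    using Suc.prems sub by (intro Suc.IH) auto
  moreover have "weighted_h_poly \<Delta> m (\<lambda>\<sigma>. top_sum \<Delta> (Suc m) f \<sigma> - f \<sigma>)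
      = weighted_h_poly \<Delta> m (\<lambda>\<sigma>. top_sum \<Delta> (Suc m) g \<sigma> - g \<sigma>)"
    using Suc.prems sub by (intro Suc.IH arg_cong2[where f = minus] top_sum_cong) auto
  ultimately show ?case by simp
qed

section \<open>Expansion of the weighted flag polynomial in flag numbers\<close>

definition dim_chains :: "'a::euclidean_space set set \<Rightarrow> nat set \<Rightarrow> 'a set set set" where
  "dim_chains \<Delta> S = {K. K \<subseteq> \<Delta> - {{0}} \<and> Complete_Partial_Order.chain (face_of) K
                         \<and> dim ` K = S \<and> card K = card S}"

text \<open>The largest member of a chain of faces is its union; inserting 0 gives \<open>{0}\<close> for the empty chain
  and adds nothing to a nonempty chain of cones.\<close>

definition chain_top :: "'a::euclidean_space set set \<Rightarrow> 'a set" where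
  "chain_top K = insert 0 (\<Union>K)"

definition weighted_flag_f :: "'a::euclidean_space set set \<Rightarrow> nat set \<Rightarrow> ('a set \<Rightarrow> int) \<Rightarrow> int" where
  "weighted_flag_f \<Delta> S f = (\<Sum>K\<in>dim_chains \<Delta> S. f (chain_top K))"

definition weighted_flag_h :: "'a::euclidean_space set set \<Rightarrow> nat set \<Rightarrow> ('a set \<Rightarrow> int) \<Rightarrow> int" where
  "weighted_flag_h \<Delta> T f = (\<Sum>S\<in>Pow T. (-1) ^ card (T - S) * weighted_flag_f \<Delta> S f)"

context nonempty_fan
begin

lemma dim_chainsD:
  assumes "K \<in> dim_chains \<Delta> S"
  shows "finite K" "K \<subseteq> \<Delta>" "{0} \<notin> K" "inj_on dim K" "dim ` K = S"
    "\<And>\<kappa> \<kappa>'. \<kappa> \<in> K \<Longrightarrow> \<kappa>' \<in> K \<Longrightarrow> dim \<kappa> \<le> dim \<kappa>' \<Longrightarrow> \<kappa> face_of \<kappa>'"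
proof -
  have *: "K \<subseteq> \<Delta> - {{0}}" "Complete_Partial_Order.chain (face_of) K" "card K = card S" and S: "dim ` K = S"
    using assms by (auto simp: dim_chains_def)
  show K: "K \<subseteq> \<Delta>" "{0} \<notin> K" using *(1) by auto
  show f: "finite K" using K(1) fin by (rule finite_subset)
  show "dim ` K = S" by (rule S)
  show "inj_on dim K" using eq_card_imp_inj_on[OF f, of dim] *(3) S by metis
  show "\<kappa> face_of \<kappa>'" if "\<kappa> \<in> K" "\<kappa>' \<in> K" "dim \<kappa> \<le> dim \<kappa>'" for \<kappa> \<kappa>'
  proof -
    have "\<kappa> face_of \<kappa>' \<or> \<kappa>' face_of \<kappa>" using *(2) that(1,2) unfolding chain_def by blast
    moreover have "\<kappa> face_of \<kappa>'" if c: "\<kappa>' face_of \<kappa>"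
      using face_dim[of \<kappa>' \<kappa>] c K(1) \<open>\<kappa> \<in> K\<close> \<open>\<kappa>' \<in> K\<close> \<open>dim \<kappa> \<le> dim \<kappa>'\<close> by (metis le_antisym subsetD)
    ultimately show ?thesis by blast
  qed
qed

lemma dim_chainsI:
  assumes "K \<subseteq> \<Delta>" "{0} \<notin> K" "inj_on dim K" "dim ` K = S"
    "\<And>\<kappa> \<kappa>'. \<kappa> \<in> K \<Longrightarrow> \<kappa>' \<in> K \<Longrightarrow> dim \<kappa> \<le> dim \<kappa>' \<Longrightarrow> \<kappa> face_of \<kappa>'"
  shows "K \<in> dim_chains \<Delta> S"
proof -
  have "Complete_Partial_Order.chain (face_of) K"
    unfolding chain_def
  proof (intro ballI)
    fix \<kappa> \<kappa>' assume "\<kappa> \<in> K" "\<kappa>' \<in> K"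
    then show "\<kappa> face_of \<kappa>' \<or> \<kappa>' face_of \<kappa>" using assms(5) le_cases[of "dim \<kappa>" "dim \<kappa>'"] by metis
  qed
  moreover have "card K = card S" using card_image[OF assms(3)] assms(4) by simp
  ultimately show ?thesis using assms(1,2,4) unfolding dim_chains_def by blast
qed

lemma chain_top_eqI:
  assumes "\<tau> \<in> K" "\<tau> \<in> \<Delta>" "\<And>\<kappa>. \<kappa> \<in> K \<Longrightarrow> \<kappa> face_of \<tau>"
  shows "chain_top K = \<tau>"
proof -
  have "{0} \<subseteq> \<tau>" using zero_face[OF assms(2)] by (rule face_of_imp_subset)
  then show ?thesis using assms(1) face_of_imp_subset[OF assms(3)] unfolding chain_top_def by blast
qed

lemma chain_top_empty: "chain_top {} = {0}"
  by (simp add: chain_top_def)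

lemma chain_top_chain:
  assumes K: "K \<in> dim_chains \<Delta> S"
  shows "chain_top K \<in> \<Delta>" "\<And>\<kappa>. \<kappa> \<in> K \<Longrightarrow> \<kappa> face_of chain_top K"
    "K \<noteq> {} \<Longrightarrow> chain_top K \<in> K"
proof -
  note D = dim_chainsD[OF K]
  have *: "chain_top K \<in> K \<and> (\<forall>\<kappa>\<in>K. \<kappa> face_of chain_top K)" if ne: "K \<noteq> {}"
  proof -
    have "Max (dim ` K) \<in> dim ` K" using D(1) ne by (intro Max_in) auto
    then obtain \<tau> where \<tau>: "\<tau> \<in> K" "dim \<tau> = Max (dim ` K)" by auto
    have all: "\<kappa> face_of \<tau>" if "\<kappa> \<in> K" for \<kappa>
      using D(6)[OF that \<tau>(1)] \<tau>(2) D(1) that by simp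
    then have "chain_top K = \<tau>" using chain_top_eqI[OF \<tau>(1)] D(2) \<tau>(1) by blast
    then show ?thesis using \<tau>(1) all by simp
  qed
  show "chain_top K \<in> \<Delta>"
  proof (cases "K = {}")
    case True
    then show ?thesis using zero_mem by (simp add: chain_top_empty)
  next
    case False
    then show ?thesis using *[OF False] D(2) by (meson subsetD)
  qed
  show "\<kappa> face_of chain_top K" if \<kappa>: "\<kappa> \<in> K" for \<kappa>
  proof -
    have "K \<noteq> {}" using \<kappa> by auto
    then show ?thesis using * \<kappa> by (meson bspec)
  qed
  show "chain_top K \<in> K" if "K \<noteq> {}" using *[OF that] by (rule conjunct1)
qed

lemma weighted_flag_f_empty: "weighted_flag_f \<Delta> {} f = f {0}"
proof -
  have "dim_chains \<Delta> {} = {{}}" by (auto simp: dim_chains_def chain_def)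
  then show ?thesis by (simp add: weighted_flag_f_def chain_top_empty)
qed

lemma finite_dim_chains: "finite (dim_chains \<Delta> S)"
  by (rule finite_subset[of _ "Pow \<Delta>"]) (use fin in \<open>auto simp: dim_chains_def\<close>)

text \<open>Removing the largest cone is a bijection from the chains with dimensions \<open>insert (Suc m) S\<close> to the
  pairs of a chain with dimensions \<open>S\<close> and a cone of dimension \<open>Suc m\<close> above all of it.\<close>

lemma weighted_flag_f_insert:
  assumes S: "S \<subseteq> {1..m}"
  shows "weighted_flag_f \<Delta> (insert (Suc m) S) f = weighted_flag_f \<Delta> S (top_sum \<Delta> (Suc m) f)"
proof -
  let ?A = "SIGMA K:dim_chains \<Delta> S. {\<tau>. \<tau> \<in> \<Delta> \<and> dim \<tau> = Suc m \<and> chain_top K face_of \<tau>}"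
  have ext: "insert \<tau> K \<in> dim_chains \<Delta> (insert (Suc m) S) \<and> chain_top (insert \<tau> K) = \<tau> \<and> \<tau> \<notin> K"
    if "(K, \<tau>) \<in> ?A" for K \<tau>
  proof -
    have K: "K \<in> dim_chains \<Delta> S" and \<tau>: "\<tau> \<in> \<Delta>" "dim \<tau> = Suc m" "chain_top K face_of \<tau>" using that by auto
    note D = dim_chainsD[OF K]
    have le: "dim \<kappa> \<le> m" if "\<kappa> \<in> K" for \<kappa> using D(5) S that by auto
    have face: "\<kappa> face_of \<tau>" if "\<kappa> \<in> K" for \<kappa>
      using chain_top_chain(2)[OF K that] \<tau>(3) by (rule face_of_trans)
    have top: "chain_top (insert \<tau> K) = \<tau>"
      using face face_self[OF \<tau>(1)] \<tau>(1) by (intro chain_top_eqI) auto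
    have nin: "\<tau> \<notin> K" using le \<tau>(2) by fastforce
    have "insert \<tau> K \<in> dim_chains \<Delta> (insert (Suc m) S)"
    proof (rule dim_chainsI)
      show "insert \<tau> K \<subseteq> \<Delta>" "{0} \<notin> insert \<tau> K" using D(2,3) \<tau>(1,2) by auto
      show "inj_on dim (insert \<tau> K)" using D(4) le \<tau>(2) unfolding inj_on_insert by fastforce
      show "dim ` insert \<tau> K = insert (Suc m) S" using D(5) \<tau>(2) by simp
      show "\<kappa> face_of \<kappa>'" if *: "\<kappa> \<in> insert \<tau> K" "\<kappa>' \<in> insert \<tau> K" "dim \<kappa> \<le> dim \<kappa>'" for \<kappa> \<kappa>'
      proof (cases "\<kappa>' = \<tau>")
        case True
        then show ?thesis using * face face_self[OF \<tau>(1)] by auto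
      next
        case False
        then have "\<kappa>' \<in> K" using * by simp
        moreover have "\<kappa> \<noteq> \<tau>" using le[OF \<open>\<kappa>' \<in> K\<close>] *(3) \<tau>(2) by auto
        ultimately show ?thesis using * D(6) by auto
      qed
    qed
    then show ?thesis using top nin by blast
  qed
  have drop: "(K - {chain_top K}, chain_top K) \<in> ?A \<and> chain_top K \<in> K"
    if K: "K \<in> dim_chains \<Delta> (insert (Suc m) S)" for K
  proof -
    note D = dim_chainsD[OF K]
    let ?t = "chain_top K"
    have "Suc m \<in> dim ` K" using D(5) by blast
    then obtain \<tau> where \<tau>: "\<tau> \<in> K" "dim \<tau> = Suc m" by auto
    then have t: "?t \<in> K" using chain_top_chain(3)[OF K] by blast
    have "dim ?t \<in> insert (Suc m) S" using D(5) t by blast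
    then have "dim ?t \<le> Suc m" using S by fastforce
    moreover have "Suc m \<le> dim ?t"
      using face_dim[OF _ _ chain_top_chain(2)[OF K \<tau>(1)]] \<tau> t D(2) by auto
    ultimately have dt: "dim ?t = Suc m" by simp
    have K': "K - {?t} \<in> dim_chains \<Delta> S"
    proof (rule dim_chainsI)
      show "inj_on dim (K - {?t})" using D(4) by (rule inj_on_subset) auto
      have "dim ` (K - {?t}) = dim ` K - {dim ?t}"
        using inj_on_image_set_diff[OF D(4), of K "{?t}"] t by simp
      then show "dim ` (K - {?t}) = S" using D(5) dt S by auto
    qed (use D in auto)
    have "chain_top (K - {?t}) face_of ?t"
    proof (cases "K - {?t} = {}")
      case True
      then show ?thesis using zero_face chain_top_chain(1)[OF K] by (simp only: chain_top_empty)
    next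
      case False
      then have "chain_top (K - {?t}) \<in> K" using chain_top_chain(3)[OF K'] by blast
      then show ?thesis by (rule chain_top_chain(2)[OF K])
    qed
    then show ?thesis using K' t dt chain_top_chain(1)[OF K] by simp
  qed
  have "weighted_flag_f \<Delta> (insert (Suc m) S) f = (\<Sum>(K, \<tau>)\<in>?A. f \<tau>)"
    unfolding weighted_flag_f_def
  proof (rule sum.reindex_bij_witness[where j = "\<lambda>K. (K - {chain_top K}, chain_top K)" and i = "\<lambda>(K, \<tau>). insert \<tau> K"])
    fix K assume K: "K \<in> dim_chains \<Delta> (insert (Suc m) S)"
    show "(case (K - {chain_top K}, chain_top K) of (K, \<tau>) \<Rightarrow> insert \<tau> K) = K" using drop[OF K] by auto
    show "(K - {chain_top K}, chain_top K) \<in> ?A" using drop[OF K] by blast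
    show "(case (K - {chain_top K}, chain_top K) of (K, \<tau>) \<Rightarrow> f \<tau>) = f (chain_top K)" by simp
  next
    fix x assume x: "x \<in> ?A"
    then obtain K \<tau> where p: "x = (K, \<tau>)" by (cases x)
    show "(case x of (K, \<tau>) \<Rightarrow> insert \<tau> K) \<in> dim_chains \<Delta> (insert (Suc m) S)"
      using ext x unfolding p by simp
    show "((case x of (K, \<tau>) \<Rightarrow> insert \<tau> K) - {chain_top (case x of (K, \<tau>) \<Rightarrow> insert \<tau> K)},
           chain_top (case x of (K, \<tau>) \<Rightarrow> insert \<tau> K)) = x"
      using ext[of K \<tau>] x unfolding p by auto
  qed
  also have "\<dots> = (\<Sum>K\<in>dim_chains \<Delta> S. \<Sum>\<tau> | \<tau> \<in> \<Delta> \<and> dim \<tau> = Suc m \<and> chain_top K face_of \<tau>. f \<tau>)"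
    using fin by (intro sum.Sigma[symmetric] finite_dim_chains) auto
  finally show ?thesis by (simp add: weighted_flag_f_def top_sum_def)
qed

lemma inj_on_insert_Pow: "a \<notin> T \<Longrightarrow> inj_on (insert a) (Pow T)"
proof (rule inj_onI)
  fix A B assume "a \<notin> T" "A \<in> Pow T" "B \<in> Pow T" "insert a A = insert a B"
  then have "a \<notin> A" "a \<notin> B" by auto
  then show "A = B" using \<open>insert a A = insert a B\<close> by (simp add: insert_ident)
qed

lemma weighted_flag_h_insert:
  assumes T: "T \<subseteq> {1..m}"
  shows "weighted_flag_h \<Delta> (insert (Suc m) T) f
       = weighted_flag_h \<Delta> T (\<lambda>\<sigma>. top_sum \<Delta> (Suc m) f \<sigma> - f \<sigma>)"
proof -
  have fT: "finite T" using finite_subset[OF T] by simp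
  have nT: "Suc m \<notin> T" using T by auto
  let ?h = "\<lambda>S. (-1) ^ card (insert (Suc m) T - S) * weighted_flag_f \<Delta> S f"
  have "weighted_flag_h \<Delta> (insert (Suc m) T) f = sum ?h (Pow T) + sum ?h (insert (Suc m) ` Pow T)"
    unfolding weighted_flag_h_def Pow_insert using fT nT by (intro sum.union_disjoint) auto
  also have "sum ?h (insert (Suc m) ` Pow T) = (\<Sum>S\<in>Pow T. ?h (insert (Suc m) S))"
    by (subst sum.reindex[OF inj_on_insert_Pow[OF nT]]) (simp add: o_def)
  also have "sum ?h (Pow T) + \<dots>
      = (\<Sum>S\<in>Pow T. (-1) ^ card (T - S) * (weighted_flag_f \<Delta> S (top_sum \<Delta> (Suc m) f) - weighted_flag_f \<Delta> S f))"
    unfolding sum.distrib[symmetric]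
  proof (rule sum.cong[OF refl])
    fix S assume "S \<in> Pow T"
    then have S: "S \<subseteq> T" "S \<subseteq> {1..m}" "Suc m \<notin> S" using T nT by auto
    have "insert (Suc m) T - S = insert (Suc m) (T - S)" "insert (Suc m) T - insert (Suc m) S = T - S"
      using S nT by auto
    then show "?h S + ?h (insert (Suc m) S)
        = (-1) ^ card (T - S) * (weighted_flag_f \<Delta> S (top_sum \<Delta> (Suc m) f) - weighted_flag_f \<Delta> S f)"
      using fT nT by (simp add: weighted_flag_f_insert[OF S(2)] algebra_simps)
  qed
  also have "\<dots> = weighted_flag_h \<Delta> T (\<lambda>\<sigma>. top_sum \<Delta> (Suc m) f \<sigma> - f \<sigma>)"
    unfolding weighted_flag_h_def weighted_flag_f_def by (simp add: sum_subtractf)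
  finally show ?thesis .
qed

lemma weighted_h_poly_expansion:
  "weighted_h_poly \<Delta> m f = (\<Sum>T\<in>Pow {1..m}. tconst (of_int (weighted_flag_h \<Delta> T f)) * (\<Prod>i\<in>T. tvar i))"
proof (induction m arbitrary: f)
  case 0
  then show ?case by (simp add: weighted_flag_h_def weighted_flag_f_empty)
next
  case (Suc m)
  let ?g = "\<lambda>\<sigma>. top_sum \<Delta> (Suc m) f \<sigma> - f \<sigma>"
  let ?h = "\<lambda>T. tconst (of_int (weighted_flag_h \<Delta> T f)) * (\<Prod>i\<in>T. tvar i)"
  have iv: "{1..Suc m} = insert (Suc m) {1..m}" by auto
  have "(\<Sum>T\<in>Pow {1..Suc m}. ?h T) = sum ?h (Pow {1..m}) + sum ?h (insert (Suc m) ` Pow {1..m})"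
    unfolding iv Pow_insert by (intro sum.union_disjoint) auto
  also have "sum ?h (insert (Suc m) ` Pow {1..m}) = (\<Sum>T\<in>Pow {1..m}. ?h (insert (Suc m) T))"
    by (subst sum.reindex[OF inj_on_insert_Pow]) (simp_all add: o_def)
  also have "\<dots> = (\<Sum>T\<in>Pow {1..m}. tvar (Suc m) * (tconst (of_int (weighted_flag_h \<Delta> T ?g)) * (\<Prod>i\<in>T. tvar i)))"
  proof (rule sum.cong[OF refl])
    fix T assume "T \<in> Pow {1..m}"
    then have T: "T \<subseteq> {1..m}" by simp
    then have "finite T" "Suc m \<notin> T" using finite_subset[OF T] by auto
    then show "?h (insert (Suc m) T) = tvar (Suc m) * (tconst (of_int (weighted_flag_h \<Delta> T ?g)) * (\<Prod>i\<in>T. tvar i))"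
      by (simp add: weighted_flag_h_insert[OF T] algebra_simps del: of_int_diff)
  qed
  finally show ?case by (simp add: Suc.IH sum_distrib_left)
qed

lemma flag_poly_eq_weighted:
  "flag_poly n \<Delta> = weighted_h_poly \<Delta> n (\<lambda>_. 1)"
proof -
  have "weighted_flag_f \<Delta> S (\<lambda>_. 1) = flag_f \<Delta> S" for S
    by (simp add: weighted_flag_f_def flag_f_def dim_chains_def)
  then have "weighted_flag_h \<Delta> T (\<lambda>_. 1) = flag_h \<Delta> T" for T
    by (simp add: weighted_flag_h_def flag_h_def)
  then show ?thesis unfolding weighted_h_poly_expansion flag_poly_def by simp
qed

end

section \<open>The two-step recursion\<close>

lemma minus_one_power_diff: "k \<le> m \<Longrightarrow> (-1) ^ (m - k) = (-1) ^ m * ((-1) ^ k :: int)"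
  by (auto simp: minus_one_power_iff)

context nonempty_fan
begin

lemma alt_sum_top_dim:
  assumes "\<sigma> \<in> \<Delta>" "dim \<sigma> = m"
  shows "alt_sum \<Delta> m f \<sigma> = f \<sigma>"
proof -
  have "{\<tau>. \<tau> \<in> skel \<Delta> m \<and> \<sigma> face_of \<tau>} = {\<sigma>}"
    using assms face_dim face_self by (auto simp: skel_def dest: le_antisym)
  then show ?thesis using assms(2) by (simp add: alt_sum_def)
qed

text \<open>After exchanging the two summations, the inner one is the signed count of the faces between
  \<open>\<sigma>\<close> and \<open>\<rho>\<close>, which leaves only the term \<open>\<rho> = \<sigma>\<close>.\<close>

lemma alt_sum_involution:
  assumes "\<sigma> \<in> skel \<Delta> m"
  shows "alt_sum \<Delta> m (alt_sum \<Delta> m f) \<sigma> = f \<sigma>"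
proof -
  have \<sigma>: "\<sigma> \<in> \<Delta>" "dim \<sigma> \<le> m" using assms by (auto simp: skel_def)
  let ?S = "skel \<Delta> m"
  have finS: "finite ?S" using fin by (simp add: skel_def)
  have "alt_sum \<Delta> m (alt_sum \<Delta> m f) \<sigma>
      = (\<Sum>\<tau>\<in>{\<tau>\<in>?S. \<sigma> face_of \<tau>}. \<Sum>\<rho>\<in>{\<rho>\<in>?S. \<tau> face_of \<rho>}. (-1) ^ (m - dim \<tau>) * ((-1) ^ (m - dim \<rho>) * f \<rho>))"
    by (simp add: alt_sum_def sum_distrib_left)
  also have "\<dots> = (\<Sum>\<rho>\<in>?S. \<Sum>\<tau>\<in>{\<tau>\<in>?S. \<sigma> face_of \<tau> \<and> \<tau> face_of \<rho>}. (-1) ^ (m - dim \<tau>) * ((-1) ^ (m - dim \<rho>) * f \<rho>))"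
  proof -
    have "(\<Sum>\<tau>\<in>{\<tau>\<in>?S. \<sigma> face_of \<tau>}. \<Sum>\<rho>\<in>{\<rho>\<in>?S. \<tau> face_of \<rho>}. h \<tau> \<rho>)
        = (\<Sum>\<rho>\<in>?S. \<Sum>\<tau>\<in>{\<tau>\<in>{\<tau>\<in>?S. \<sigma> face_of \<tau>}. \<tau> face_of \<rho>}. h \<tau> \<rho>)" for h :: "'a set \<Rightarrow> 'a set \<Rightarrow> int"
      using finS by (intro sum.swap_restrict) auto
    then show ?thesis by (simp add: conj_assoc)
  qed
  also have "\<dots> = (\<Sum>\<rho>\<in>?S. if \<rho> = \<sigma> then f \<sigma> else 0)"
  proof (rule sum.cong[OF refl])
    fix \<rho> assume "\<rho> \<in> ?S"
    then have \<rho>: "\<rho> \<in> \<Delta>" "dim \<rho> \<le> m" by (auto simp: skel_def)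
    let ?I = "{\<tau>\<in>?S. \<sigma> face_of \<tau> \<and> \<tau> face_of \<rho>}"
    have I: "?I = {\<tau>. \<sigma> face_of \<tau> \<and> \<tau> face_of \<rho>}"
      using between[OF \<sigma>(1) \<rho>(1)] face_dim[OF _ \<rho>(1)] \<rho>(2) by (force simp: skel_def)
    have "(\<Sum>\<tau>\<in>?I. (-1) ^ (m - dim \<tau>) * ((-1) ^ (m - dim \<rho>) * f \<rho>))
        = (\<Sum>\<tau>\<in>?I. (-1) ^ m * ((-1) ^ (m - dim \<rho>) * f \<rho>) * (-1) ^ dim \<tau>)"
      by (intro sum.cong refl) (simp add: skel_def minus_one_power_diff)
    also have "\<dots> = (-1) ^ m * ((-1) ^ (m - dim \<rho>) * f \<rho>) * (\<Sum>\<tau>\<in>?I. (-1) ^ dim \<tau>)"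
      by (simp add: sum_distrib_left)
    finally have eq: "(\<Sum>\<tau>\<in>?I. (-1) ^ (m - dim \<tau>) * ((-1) ^ (m - dim \<rho>) * f \<rho>))
        = (-1) ^ m * ((-1) ^ (m - dim \<rho>) * f \<rho>) * (\<Sum>\<tau>\<in>?I. (-1) ^ dim \<tau>)" .
    show "(\<Sum>\<tau>\<in>?I. (-1) ^ (m - dim \<tau>) * ((-1) ^ (m - dim \<rho>) * f \<rho>)) = (if \<rho> = \<sigma> then f \<sigma> else 0)"
    proof (cases "\<rho> = \<sigma>")
      case True
      have "?I = {\<sigma>}"
        using \<sigma> face_self[OF \<sigma>(1)] unfolding True
        by (auto simp: skel_def dest: face_of_imp_subset)
      moreover have "(-1) ^ m * ((-1) ^ (m - dim \<sigma>) * (-1) ^ dim \<sigma>) = (1::int)"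
        using \<sigma>(2) by (simp add: minus_one_power_diff power_mult_distrib[symmetric] mult.assoc[symmetric])
      ultimately show ?thesis unfolding eq using True by (simp add: mult.assoc mult.left_commute)
    next
      case False
      show ?thesis
      proof (cases "\<sigma> face_of \<rho>")
        case True
        then show ?thesis using eq False interval[OF \<sigma>(1) \<rho>(1)] by (simp add: I)
      next
        case nf: False
        then have "?I = {}" using face_of_trans by blast
        then show ?thesis using False by (simp only: sum.empty if_False)
      qed
    qed
  qed
  also have "\<dots> = f \<sigma>" using assms finS by simp
  finally show ?thesis .
qed

lemma top_sum_eq:
  "top_sum \<Delta> (Suc m) f \<sigma> = alt_sum \<Delta> (Suc m) f \<sigma> + alt_sum \<Delta> m f \<sigma>"
  using alt_sum_Suc[OF fin] by simp

text \<open>This agrees with \<open>weighted_h_poly\<close> when \<open>f\<close> is fixed by \<open>alt_sum\<close>, but for positive \<open>m\<close> it depends only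
  on the values of \<open>f\<close> below dimension \<open>m\<close>, and it satisfies the recursion of \<open>\<phi>\<close> for every \<open>f\<close>.\<close>

fun paired_h_poly :: "nat \<Rightarrow> ('a set \<Rightarrow> int) \<Rightarrow> tpoly" where
  "paired_h_poly 0 f = tconst (of_int (f {0}))"
| "paired_h_poly (Suc m) f =
     weighted_h_poly \<Delta> m f + tvar (Suc m) * weighted_h_poly \<Delta> m (alt_sum \<Delta> m f)"

lemma paired_h_poly_fixed:
  assumes "\<And>\<sigma>. \<sigma> \<in> skel \<Delta> m \<Longrightarrow> alt_sum \<Delta> m f \<sigma> = f \<sigma>"
  shows "paired_h_poly m f = weighted_h_poly \<Delta> m f"
proof (cases m)
  case (Suc k)
  have "weighted_h_poly \<Delta> k (\<lambda>\<sigma>. top_sum \<Delta> (Suc k) f \<sigma> - f \<sigma>) = weighted_h_poly \<Delta> k (alt_sum \<Delta> k f)"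
    using assms by (intro weighted_h_poly_cong[OF zero_mem]) (simp add: top_sum_eq Suc skel_def)
  then show ?thesis by (simp add: Suc)
qed simp

lemma paired_h_poly_cong:
  assumes "\<And>\<sigma>. \<sigma> \<in> skel \<Delta> (m - 1) \<Longrightarrow> f \<sigma> = g \<sigma>"
  shows "paired_h_poly m f = paired_h_poly m g"
proof (cases m)
  case 0
  then show ?thesis using assms[of "{0}"] zero_mem by (simp add: skel_def)
next
  case (Suc k)
  have "weighted_h_poly \<Delta> k f = weighted_h_poly \<Delta> k g"
    using assms by (intro weighted_h_poly_cong[OF zero_mem]) (simp add: Suc)
  moreover have "alt_sum \<Delta> k f = alt_sum \<Delta> k g"
    using assms by (intro ext alt_sum_cong) (simp add: Suc)
  ultimately show ?thesis by (simp add: Suc)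
qed

lemma paired_h_poly_1: "paired_h_poly (Suc 0) f = tconst (of_int (f {0})) * (tvar 1 + 1)"
  using alt_sum_top_dim[OF zero_mem, of 0 f] by (simp add: algebra_simps)

text \<open>This is \<open>(E - Id)(f)\<close>, of which \<open>D\<close> takes a restriction.\<close>

definition alt_defect :: "nat \<Rightarrow> ('a set \<Rightarrow> int) \<Rightarrow> 'a set \<Rightarrow> int" where
  "alt_defect m f \<sigma> = alt_sum \<Delta> m f \<sigma> - f \<sigma>"

text \<open>The defect changes sign under \<open>alt_sum\<close> one level up, by \<open>alt_sum_involution\<close>, and vanishes on the
  cones of dimension \<open>Suc m\<close>; discarding the latter flips the sign once more.\<close>

lemma alt_sum_defect:
  assumes "\<sigma> \<in> skel \<Delta> m"
  shows "alt_sum \<Delta> m (alt_defect (Suc m) f) \<sigma> = alt_defect (Suc m) f \<sigma>"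
proof -
  have \<sigma>: "\<sigma> \<in> skel \<Delta> (Suc m)" using assms by (auto simp: skel_def)
  have "top_sum \<Delta> (Suc m) (alt_defect (Suc m) f) \<sigma> = 0"
    unfolding top_sum_def by (intro sum.neutral) (auto simp: alt_defect_def alt_sum_top_dim)
  moreover have "alt_sum \<Delta> (Suc m) (alt_defect (Suc m) f) \<sigma> = - alt_defect (Suc m) f \<sigma>"
    using alt_sum_involution[OF \<sigma>] unfolding alt_defect_def alt_sum_diff by simp
  ultimately show ?thesis using top_sum_eq[of m "alt_defect (Suc m) f" \<sigma>] by simp
qed

text \<open>With \<open>b = E f\<close> and \<open>P = weighted_h_poly \<Delta> m\<close>, both sides are combinations of \<open>P f\<close>, \<open>P b\<close> and
  \<open>P (E f)\<close>: the fourth term \<open>P (E b)\<close> is eliminated by \<open>alt_sum_defect\<close>, which says that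
  \<open>E b - E f = b - f\<close> one level down.\<close>

lemma paired_h_poly_rec:
  "paired_h_poly (Suc (Suc m)) f = paired_h_poly (Suc m) f * (tvar (Suc (Suc m)) + 1)
     + paired_h_poly m (alt_defect (Suc m) f) * (tvar (Suc m) + tvar (Suc (Suc m)))"
proof -
  let ?P = "weighted_h_poly \<Delta> m" and ?E = "alt_sum \<Delta> m"
  define b where "b = alt_sum \<Delta> (Suc m) f"
  have e: "alt_defect (Suc m) f = (\<lambda>\<sigma>. b \<sigma> - f \<sigma>)" by (simp add: alt_defect_def b_def fun_eq_iff)
  have Pe: "paired_h_poly m (alt_defect (Suc m) f) = ?P b - ?P f"
  proof -
    have "paired_h_poly m (alt_defect (Suc m) f) = ?P (alt_defect (Suc m) f)"
      by (rule paired_h_poly_fixed[OF alt_sum_defect])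
    also have "\<dots> = ?P b - ?P f" unfolding e by (rule weighted_h_poly_diff)
    finally show ?thesis .
  qed
  have "?P (\<lambda>\<sigma>. ?E b \<sigma> - ?E f \<sigma>) = ?P (\<lambda>\<sigma>. b \<sigma> - f \<sigma>)"
    using alt_sum_defect[of _ m f] unfolding e alt_sum_diff by (intro weighted_h_poly_cong[OF zero_mem])
  then have Eb: "?P (?E b) = ?P (?E f) + ?P b - ?P f"
    unfolding weighted_h_poly_diff by (simp add: algebra_simps)
  have tf: "?P (\<lambda>\<sigma>. top_sum \<Delta> (Suc m) f \<sigma> - f \<sigma>) = ?P b + ?P (?E f) - ?P f"
    unfolding top_sum_eq weighted_h_poly_diff weighted_h_poly_add b_def by simp
  have "?P (\<lambda>\<sigma>. top_sum \<Delta> (Suc m) b \<sigma> - b \<sigma>) = ?P (\<lambda>\<sigma>. f \<sigma> + ?E b \<sigma> - b \<sigma>)"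
  proof (rule weighted_h_poly_cong[OF zero_mem])
    fix \<sigma> assume "\<sigma> \<in> skel \<Delta> m"
    then have "\<sigma> \<in> skel \<Delta> (Suc m)" by (auto simp: skel_def)
    then show "top_sum \<Delta> (Suc m) b \<sigma> - b \<sigma> = f \<sigma> + ?E b \<sigma> - b \<sigma>"
      using alt_sum_involution[of \<sigma> "Suc m" f] by (simp add: top_sum_eq b_def)
  qed
  then have tb: "?P (\<lambda>\<sigma>. top_sum \<Delta> (Suc m) b \<sigma> - b \<sigma>) = ?P f + ?P (?E b) - ?P b"
    unfolding weighted_h_poly_diff weighted_h_poly_add .
  have "paired_h_poly (Suc (Suc m)) f = ?P f + tvar (Suc m) * (?P b + ?P (?E f) - ?P f)
      + tvar (Suc (Suc m)) * (?P b + tvar (Suc m) * (?P f + ?P (?E b) - ?P b))"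
    by (simp add: b_def[symmetric] tf tb)
  also have "\<dots> = (?P f + tvar (Suc m) * ?P (?E f)) * (tvar (Suc (Suc m)) + 1)
      + (?P b - ?P f) * (tvar (Suc m) + tvar (Suc (Suc m)))"
    unfolding Eb by (simp add: algebra_simps)
  also have "\<dots> = paired_h_poly (Suc m) f * (tvar (Suc (Suc m)) + 1)
     + paired_h_poly m (alt_defect (Suc m) f) * (tvar (Suc m) + tvar (Suc (Suc m)))"
    by (simp add: Pe)
  finally show ?thesis .
qed

end

section \<open>Words, and the recursion unrolled\<close>

lemma cd_deg_simps [simp]:
  "cd_deg [] = 0" "cd_deg (l # w) = letter_deg l + cd_deg w" "cd_deg (u @ v) = cd_deg u + cd_deg v"
  by (simp_all add: cd_deg_def)

lemma words_of_degree_0: "{w. cd_deg w = 0} = {[]}"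
proof -
  have "w = []" if "cd_deg w = 0" for w
  proof (cases w)
    case (Cons l u)
    then show ?thesis using that by (cases l) auto
  qed simp
  then show ?thesis by auto
qed

lemma words_of_degree_1: "{w. cd_deg w = Suc 0} = {[Letter_c]}"
proof -
  have "w = [Letter_c]" if "cd_deg w = Suc 0" for w
  proof (cases w)
    case (Cons l u)
    then have "l = Letter_c \<and> cd_deg u = 0" using that by (cases l) auto
    then show ?thesis using Cons words_of_degree_0 by auto
  qed (use that in simp)
  then show ?thesis by auto
qed

lemma words_of_degree_Suc_Suc:
  "{w. cd_deg w = Suc (Suc m)} =
     (\<lambda>w. w @ [Letter_c]) ` {w. cd_deg w = Suc m} \<union> (\<lambda>w. w @ [Letter_d]) ` {w. cd_deg w = m}"
  (is "?L = ?R")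
proof
  show "?L \<subseteq> ?R"
  proof
    fix w assume w: "w \<in> ?L"
    then have "w \<noteq> []" by auto
    then obtain u l where "w = u @ [l]" by (metis rev_exhaust)
    then show "w \<in> ?R" using w by (cases l) auto
  qed
qed auto

lemma finite_words_of_degree: "finite {w. cd_deg w = m}"
proof (induction m rule: induct_nat_012)
qed (auto simp: words_of_degree_0 words_of_degree_1 words_of_degree_Suc_Suc)

lemma sum_words_of_degree_Suc_Suc:
  "(\<Sum>w | cd_deg w = Suc (Suc m). F w) =
     (\<Sum>w | cd_deg w = Suc m. F (w @ [Letter_c])) + (\<Sum>w | cd_deg w = m. F (w @ [Letter_d]))"
  unfolding words_of_degree_Suc_Suc
  by (subst sum.union_disjoint) (auto simp: finite_words_of_degree sum.reindex inj_on_def)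

text \<open>Words grow at the right end in the recursion for \<open>\<phi>\<close>, whereas \<open>word_op\<close> recurses at the left.\<close>

lemma word_op_snoc:
  "word_op \<Delta> m (w @ [l]) f = word_op \<Delta> (m - letter_deg l) w (letter_op \<Delta> l m f)"
  by (induction w) (simp_all add: add.commute)

lemma (in nonempty_fan) paired_h_poly_words:
  "paired_h_poly m f = (\<Sum>w | cd_deg w = m. tconst (of_int (word_op \<Delta> m w f {0})) * phi_word w)"
proof (induction m arbitrary: f rule: induct_nat_012)
  case 0
  then show ?case by (simp add: words_of_degree_0 phi_word_Nil)
next
  case 1
  have "phi_word [Letter_c] = tvar 1 + 1" using phi_word_snoc_c[of "[]"] by (simp add: phi_word_Nil)
  then show ?case unfolding paired_h_poly_1 using zero_mem
    by (simp add: words_of_degree_1 op_C_def skel_def)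
next
  case (ge2 m)
  let ?C = "op_C \<Delta> (Suc (Suc m)) f" and ?D = "op_D \<Delta> (Suc (Suc m)) f"
  have "paired_h_poly (Suc m) f = paired_h_poly (Suc m) ?C"
    by (intro paired_h_poly_cong) (auto simp: op_C_def skel_def)
  moreover have "paired_h_poly m (alt_defect (Suc m) f) = paired_h_poly m ?D"
  proof (rule paired_h_poly_cong)
    fix \<sigma> assume "\<sigma> \<in> skel \<Delta> (m - 1)"
    then have \<sigma>: "\<sigma> \<in> skel \<Delta> m" "\<sigma> \<in> skel \<Delta> (Suc m)" by (auto simp: skel_def)
    have "alt_sum \<Delta> (Suc m) ?C \<sigma> = alt_sum \<Delta> (Suc m) f \<sigma>"
      by (intro alt_sum_cong) (simp add: op_C_def)
    then show "alt_defect (Suc m) f \<sigma> = ?D \<sigma>"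
      using \<sigma> by (simp add: op_D_def op_C_def op_E_def alt_defect_def alt_sum_def)
  qed
  ultimately have "paired_h_poly (Suc (Suc m)) f
      = paired_h_poly (Suc m) ?C * (tvar (Suc (Suc m)) + 1)
      + paired_h_poly m ?D * (tvar (Suc m) + tvar (Suc (Suc m)))"
    by (simp only: paired_h_poly_rec)
  also have "\<dots> = (\<Sum>w | cd_deg w = Suc (Suc m). tconst (of_int (word_op \<Delta> (Suc (Suc m)) w f {0})) * phi_word w)"
    unfolding sum_words_of_degree_Suc_Suc ge2.IH sum_distrib_right
    by (intro arg_cong2[where f = plus] sum.cong refl)
       (simp_all add: word_op_snoc phi_word_snoc_c phi_word_snoc_d mult.assoc)
  finally show ?case .
qed

section \<open>Injectivity of the map from words to polynomials\<close>

lemma lookup_times_tvar: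
  "Poly_Mapping.lookup (p * tvar i) k = (\<Sum>l. Poly_Mapping.lookup p l when k = l + Poly_Mapping.single i 1)"
proof -
  have *: "(\<Sum>q. Poly_Mapping.lookup (tvar i) q when k = l + q) = (1 when k = l + Poly_Mapping.single i 1)" for l
  proof -
    have "(\<lambda>q. Poly_Mapping.lookup (tvar i) q when k = l + q)
        = (\<lambda>q. (1 when k = l + Poly_Mapping.single i 1) when q = Poly_Mapping.single i 1)"
      by (auto simp: fun_eq_iff tvar_def lookup_single when_def)
    then show ?thesis by (simp only: Sum_any_when_equal)
  qed
  show ?thesis unfolding lookup_mult * by (intro Sum_any.cong) (simp add: when_def)
qed

lemma lookup_times_tvar_add:
  "Poly_Mapping.lookup (p * tvar i) (k + Poly_Mapping.single i 1) = Poly_Mapping.lookup p k"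
  unfolding lookup_times_tvar by simp

lemma lookup_times_tvar_0:
  assumes "Poly_Mapping.lookup k i = 0"
  shows "Poly_Mapping.lookup (p * tvar i) k = 0"
proof -
  have "k \<noteq> l + Poly_Mapping.single i 1" for l using assms by (auto simp: lookup_add)
  then show ?thesis unfolding lookup_times_tvar by simp
qed

text \<open>The polynomial involves only the variables \<open>t\<^sub>i\<close> with \<open>i \<le> n\<close> (including \<open>t\<^sub>0\<close>).\<close>

definition vars_upto :: "nat \<Rightarrow> tpoly \<Rightarrow> bool" where
  "vars_upto n p \<longleftrightarrow> (\<forall>k i. i > n \<longrightarrow> Poly_Mapping.lookup k i \<noteq> 0 \<longrightarrow> Poly_Mapping.lookup p k = 0)"

lemma vars_upto_mono: "vars_upto m p \<Longrightarrow> m \<le> n \<Longrightarrow> vars_upto n p"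
  unfolding vars_upto_def by (meson le_less_trans)

lemma vars_upto_add: "vars_upto n p \<Longrightarrow> vars_upto n q \<Longrightarrow> vars_upto n (p + q)"
  unfolding vars_upto_def by (auto simp: lookup_add)

lemma vars_upto_sum: "(\<And>x. x \<in> A \<Longrightarrow> vars_upto n (f x)) \<Longrightarrow> vars_upto n (sum f A)"
proof (induction A rule: infinite_finite_induct)
  case (insert x F)
  then show ?case by (simp add: vars_upto_add)
qed (auto simp: vars_upto_def)

lemma vars_upto_mult: 
  assumes "vars_upto n p" "vars_upto n q" shows "vars_upto n (p * q)"
  unfolding vars_upto_def
proof (intro allI impI)
  fix k :: "nat \<Rightarrow>\<^sub>0 nat" and i assume *: "i > n" "Poly_Mapping.lookup k i \<noteq> 0"
  have z: "Poly_Mapping.lookup p l * (\<Sum>r. Poly_Mapping.lookup q r when k = l + r) = 0" for l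
  proof (cases "Poly_Mapping.lookup l i = 0")
    case True
    have "(Poly_Mapping.lookup q r when k = l + r) = 0" for r
    proof (cases "k = l + r")
      case t: True
      then have "Poly_Mapping.lookup r i \<noteq> 0" using * True by (auto simp: lookup_add)
      then show ?thesis using assms(2) *(1) by (simp add: vars_upto_def)
    qed simp
    then show ?thesis by simp
  next
    case False
    then show ?thesis using assms(1) *(1) by (simp add: vars_upto_def)
  qed
  then show "Poly_Mapping.lookup (p * q) k = 0" unfolding lookup_mult z by simp
qed

lemma vars_upto_tconst: "vars_upto n (tconst a)"
  by (auto simp: vars_upto_def tconst_def lookup_single when_def)

lemma vars_upto_1: "vars_upto n 1"
  using vars_upto_tconst[of n 1] by (simp add: tconst_def)

lemma vars_upto_tvar: "i \<le> n \<Longrightarrow> vars_upto n (tvar i)"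
  by (auto simp: vars_upto_def tvar_def lookup_single when_def)

lemma vars_upto_phi_word: "vars_upto (cd_deg w) (phi_word w)"
proof (induction w rule: rev_induct)
  case Nil
  then show ?case by (simp add: phi_word_Nil vars_upto_1)
next
  case (snoc l w)
  show ?case
  proof (cases l)
    case Letter_c
    then show ?thesis using vars_upto_mono[OF snoc]
      by (simp add: phi_word_snoc_c vars_upto_mult vars_upto_add vars_upto_1 vars_upto_tvar)
  next
    case Letter_d
    then show ?thesis using vars_upto_mono[OF snoc]
      by (simp add: phi_word_snoc_d vars_upto_mult vars_upto_add vars_upto_tvar)
  qed
qed

text \<open>Compare coefficients.  Monomials free of the two last variables show that \<open>p\<close> has no such terms;
  multiplying such a monomial by the last variable then shows the same for \<open>q\<close>, so \<open>q = 0\<close>, and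
  \<open>p = 0\<close> follows from the monomials free of the last variable.\<close>

lemma cd_split_zero:
  assumes p: "vars_upto (Suc m) p" and q: "vars_upto m q"
    and eq: "p * (tvar (Suc (Suc m)) + 1) + q * (tvar (Suc m) + tvar (Suc (Suc m))) = 0"
  shows "p = 0" "q = 0"
proof -
  let ?s = "tvar (Suc m)" and ?t = "tvar (Suc (Suc m))"
  let ?l = "Poly_Mapping.lookup" and ?e = "Poly_Mapping.single (Suc (Suc m)) (1 :: nat)"
  have coeff: "?l (p * ?t) k + ?l p k + ?l (q * ?s) k + ?l (q * ?t) k = 0" for k
  proof -
    have "?l (p * ?t + p + q * ?s + q * ?t) k = 0"
      using arg_cong[OF eq, of "\<lambda>r. ?l r k"] by (simp add: algebra_simps)
    then show ?thesis by (simp add: lookup_add)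
  qed
  have p0: "?l p k = 0" if "?l k (Suc m) = 0" "?l k (Suc (Suc m)) = 0" for k
    using coeff[of k] that by (simp add: lookup_times_tvar_0)
  show "q = 0"
  proof (rule poly_mapping_eqI)
    fix k
    show "?l q k = ?l 0 k"
    proof (cases "?l k (Suc m) = 0 \<and> ?l k (Suc (Suc m)) = 0")
      case True
      have "?l p (k + ?e) = 0"
        using p unfolding vars_upto_def by (metis lessI lookup_add lookup_single_eq add_is_0 zero_neq_one)
      moreover have "?l (q * ?s) (k + ?e) = 0"
        using True by (intro lookup_times_tvar_0) (simp add: lookup_add lookup_single)
      ultimately have "?l p k + ?l q k = 0"
        using coeff[of "k + ?e"] by (simp only: lookup_times_tvar_add)
      then show ?thesis using p0 True by simp
    next
      case False
      then show ?thesis using q unfolding vars_upto_def by (metis lessI less_SucI lookup_zero)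
    qed
  qed
  show "p = 0"
  proof (rule poly_mapping_eqI)
    fix k
    show "?l p k = ?l 0 k"
    proof (cases "?l k (Suc (Suc m)) = 0")
      case True
      then show ?thesis using coeff[of k] \<open>q = 0\<close> by (simp add: lookup_times_tvar_0)
    next
      case False
      then show ?thesis using p unfolding vars_upto_def by (metis lessI lookup_zero)
    qed
  qed
qed

lemma tconst_eq_0_iff: "tconst a = 0 \<longleftrightarrow> a = 0"
  unfolding tconst_def by (metis lookup_single_eq lookup_zero single_zero)

lemma phi_words_independent:
  assumes "(\<Sum>w | cd_deg w = m. tconst (a w) * phi_word w) = 0" "cd_deg w = m"
  shows "a w = 0"
  using assms
proof (induction m arbitrary: a w rule: induct_nat_012)
  case 0
  then have "w = []" using words_of_degree_0 by auto
  then show ?case using 0 by (simp add: words_of_degree_0 phi_word_Nil tconst_eq_0_iff)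
next
  case 1
  then have w: "w = [Letter_c]" using words_of_degree_1 by auto
  have "tconst (a w) * (tvar 1 + 1) = 0"
    using 1(1) phi_word_snoc_c[of "[]"] by (simp add: words_of_degree_1 phi_word_Nil w)
  then have "tconst (a w) * tvar 1 + tconst (a w) = 0" by (simp add: algebra_simps)
  then have "Poly_Mapping.lookup (tconst (a w) * tvar 1 + tconst (a w)) 0 = 0" by simp
  then have "Poly_Mapping.lookup (tconst (a w)) 0 = 0" 
    by (simp only: lookup_add) (simp add: lookup_times_tvar_0)
  then show ?case by (simp add: tconst_def)
next
  case (ge2 m)
  define p where "p = (\<Sum>w | cd_deg w = Suc m. tconst (a (w @ [Letter_c])) * phi_word w)"
  define q where "q = (\<Sum>w | cd_deg w = m. tconst (a (w @ [Letter_d])) * phi_word w)"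
  have vp: "vars_upto (Suc m) p"
    unfolding p_def using vars_upto_phi_word
    by (intro vars_upto_sum vars_upto_mult vars_upto_tconst) (metis (mono_tags) mem_Collect_eq)
  have vq: "vars_upto m q"
    unfolding q_def using vars_upto_phi_word
    by (intro vars_upto_sum vars_upto_mult vars_upto_tconst) (metis (mono_tags) mem_Collect_eq)
  have "p * (tvar (Suc (Suc m)) + 1) + q * (tvar (Suc m) + tvar (Suc (Suc m)))
      = (\<Sum>w | cd_deg w = Suc (Suc m). tconst (a w) * phi_word w)"
    unfolding sum_words_of_degree_Suc_Suc p_def q_def sum_distrib_right
    by (intro arg_cong2[where f = plus] sum.cong refl)
       (simp_all add: phi_word_snoc_c phi_word_snoc_d mult.assoc)
  then have "p = 0" "q = 0" using cd_split_zero[OF vp vq] ge2.prems(1) by simp_all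
  then have IH: "a (u @ [Letter_c]) = 0" if "cd_deg u = Suc m" for u
    using ge2.IH(2)[of "\<lambda>u. a (u @ [Letter_c])" u] that unfolding p_def by simp
  have IH': "a (u @ [Letter_d]) = 0" if "cd_deg u = m" for u
    using ge2.IH(1)[of "\<lambda>u. a (u @ [Letter_d])" u] that \<open>q = 0\<close> unfolding q_def by simp
  have "w \<in> {w. cd_deg w = Suc (Suc m)}" using ge2.prems(2) by simp
  then show ?case unfolding words_of_degree_Suc_Suc using IH IH' by auto
qed

lemma phi_homogeneous:
  assumes "cd_homogeneous n \<Phi>"
  shows "phi \<Phi> = (\<Sum>w | cd_deg w = n. tconst (Poly_Mapping.lookup \<Phi> w) * phi_word w)"
  unfolding phi_def
proof (rule sum.mono_neutral_left)
  show "\<forall>w\<in>{w. cd_deg w = n} - Poly_Mapping.keys \<Phi>. tconst (Poly_Mapping.lookup \<Phi> w) * phi_word w = 0"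
    by (auto simp: in_keys_iff tconst_def)
qed (use assms in \<open>auto simp: finite_words_of_degree cd_homogeneous_def\<close>)

text \<open>Any expansion of the flag polynomial in the \<open>\<phi>(w)\<close> exhibits a candidate for the cd-index, and
  independence of the \<open>\<phi>(w)\<close> makes it the only one.\<close>

lemma cd_index_eqI:
  fixes a :: "cd_word \<Rightarrow> real"
  assumes "flag_poly n \<Delta> = (\<Sum>w | cd_deg w = n. tconst (a w) * phi_word w)"
    and "cd_deg w = n"
  shows "Poly_Mapping.lookup (cd_index n \<Delta>) w = a w"
proof -
  define \<Phi> where "\<Phi> = (\<Sum>w | cd_deg w = n. Poly_Mapping.single w (a w))"
  have lk: "Poly_Mapping.lookup \<Phi> v = (a v when cd_deg v = n)" for v
  proof -
    have "Poly_Mapping.lookup \<Phi> v = (\<Sum>w | cd_deg w = n. if w = v then a v else 0)"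
      unfolding \<Phi>_def lookup_sum by (intro sum.cong refl) (simp add: lookup_single when_def)
    then show ?thesis by (simp add: finite_words_of_degree when_def)
  qed
  then have hom: "cd_homogeneous n \<Phi>" by (auto simp: cd_homogeneous_def in_keys_iff when_def split: if_splits)
  have "phi \<Phi> = (\<Sum>w | cd_deg w = n. tconst (a w) * phi_word w)"
    unfolding phi_homogeneous[OF hom] by (intro sum.cong refl) (simp add: lk)
  then have ex: "cd_homogeneous n \<Phi> \<and> flag_poly n \<Delta> = phi \<Phi>" using hom assms(1) by simp
  have "\<Psi> = \<Phi>" if \<Psi>: "cd_homogeneous n \<Psi> \<and> flag_poly n \<Delta> = phi \<Psi>" for \<Psi>
  proof (rule poly_mapping_eqI)
    fix v
    have "(\<Sum>w | cd_deg w = n. tconst (Poly_Mapping.lookup \<Psi> w - Poly_Mapping.lookup \<Phi> w) * phi_word w)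
        = phi \<Psi> - phi \<Phi>"
      unfolding phi_homogeneous[OF hom] phi_homogeneous[OF \<Psi>[THEN conjunct1]]
      by (simp add: tconst_diff left_diff_distrib sum_subtractf)
    also have "\<dots> = 0" using \<Psi> ex by simp
    finally have "Poly_Mapping.lookup \<Psi> v - Poly_Mapping.lookup \<Phi> v = 0" if "cd_deg v = n"
      using phi_words_independent[where a = "\<lambda>w. Poly_Mapping.lookup \<Psi> w - Poly_Mapping.lookup \<Phi> w" and m = n and w = v] that by simp
    moreover have "v \<notin> Poly_Mapping.keys \<Psi>" "v \<notin> Poly_Mapping.keys \<Phi>" if "cd_deg v \<noteq> n"
      using \<Psi> hom that by (auto simp: cd_homogeneous_def)
    ultimately show "Poly_Mapping.lookup \<Psi> v = Poly_Mapping.lookup \<Phi> v"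
      by (cases "cd_deg v = n") (auto simp: in_keys_iff)
  qed
  then have "cd_index n \<Delta> = \<Phi>" unfolding cd_index_def using ex by (intro the_equality) auto
  then show ?thesis using lk assms(2) by simp
qed

section \<open>Coefficients of the cd-index\<close>

theorem proposition1p2:
  fixes V :: "'a::euclidean_space set" and \<Delta> :: "'a set set" and n :: nat and w :: cd_word
  assumes "complete_fan V \<Delta>" and "dim V = n" and "cd_deg w = n"
  shows "real_of_int (word_op \<Delta> n w (one_fun \<Delta>) {0}) = Poly_Mapping.lookup (cd_index n \<Delta>) w"
proof -
  have "fan \<Delta>" "subspace V" and V: "\<Union>\<Delta> = V" using assms(1) by (auto simp: complete_fan_def)
  then have "\<Delta> \<noteq> {}" using subspace_0 by fastforce
  then interpret nonempty_fan \<Delta> using \<open>fan \<Delta>\<close> by unfold_locales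
  have dims: "dim \<tau> \<le> n" if "\<tau> \<in> \<Delta>" for \<tau>
  proof -
    have "\<tau> \<subseteq> V" using that V by blast
    then show ?thesis using dim_subset assms(2) by blast
  qed
  have skel: "skel \<Delta> n = \<Delta>" using dims by (auto simp: skel_def)
  have one: "one_fun \<Delta> \<sigma> = 1" if "\<sigma> \<in> \<Delta>" for \<sigma> using that by (simp add: one_fun_def)
  have fixed: "alt_sum \<Delta> n (one_fun \<Delta>) \<sigma> = one_fun \<Delta> \<sigma>" if \<sigma>: "\<sigma> \<in> skel \<Delta> n" for \<sigma>
  proof -
    have "alt_sum \<Delta> n (one_fun \<Delta>) \<sigma> = (\<Sum>\<tau> | \<tau> \<in> \<Delta> \<and> \<sigma> face_of \<tau>. (-1) ^ n * (-1) ^ dim \<tau>)"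
      unfolding alt_sum_def skel by (intro sum.cong refl) (simp add: one minus_one_power_diff dims)
    also have "\<dots> = (-1) ^ n * (-1) ^ dim V"
      using complete_fan_star_euler[OF assms(1)] \<sigma> by (simp add: skel sum_distrib_left[symmetric])
    also have "\<dots> = 1" using assms(2) by (simp add: power_mult_distrib[symmetric])
    finally show ?thesis using one \<sigma> by (simp add: skel)
  qed
  have "flag_poly n \<Delta> = weighted_h_poly \<Delta> n (\<lambda>_. 1)" by (rule flag_poly_eq_weighted)
  also have "\<dots> = weighted_h_poly \<Delta> n (one_fun \<Delta>)"
    by (intro weighted_h_poly_cong[OF zero_mem]) (simp add: skel one)
  also have "\<dots> = paired_h_poly n (one_fun \<Delta>)" by (rule paired_h_poly_fixed[OF fixed, symmetric])
  also have "\<dots> = (\<Sum>w | cd_deg w = n. tconst (of_int (word_op \<Delta> n w (one_fun \<Delta>) {0})) * phi_word w)"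
    by (rule paired_h_poly_words)
  finally have expansion: "flag_poly n \<Delta> =
      (\<Sum>w | cd_deg w = n. tconst (of_int (word_op \<Delta> n w (one_fun \<Delta>) {0})) * phi_word w)" .
  show ?thesis
    by (rule cd_index_eqI[where a = "\<lambda>w. of_int (word_op \<Delta> n w (one_fun \<Delta>) {0})", OF expansion assms(3), symmetric])
qed

end
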